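(* Let $k\ge1$ and let $\mathcal{X}\subseteq\Omega_k$ be a closed set of permutations whose basis is regular (in particular, this holds if the basis is finite). Then: (i) the enumeration sequence $(a_n)_{n\ge0}$ of $\mathcal{X}$, where $a_n$ is the number of permutations of length $n$ in $\mathcal{X}$, satisfies a linear recurrence with constant coefficients; (ii) membership in $\mathcal{X}$ can be checked in linear time.
   Context: A permutation of length $n\ge 0$ is an arrangement $\pi=\pi_1\ldots\pi_n$ of $1,\ldots,n$ (the empty permutation is allowed). $\pi\preceq\sigma$ ($\pi$ is involved in $\sigma$) means $\pi$ is order isomorphic to a (not necessarily contiguous) subsequence of $\sigma$. A set $\mathcal{X}$ of permutations is closed if $\sigma\in\mathcal{X}$ and $\pi\preceq\sigma$ imply $\pi\in\mathcal{X}$. The basis of a closed set $\mathcal{X}$ is the set of $\preceq$-minimal permutations not belonging to $\mathcal{X}$. For $k\ge1$, $\Omega_k$ is the closed set whose basis consists of the $k!$ permutations $k+1,a_1,\ldots,a_k$ of length $k+1$, where $a_1,\ldots,a_k$ ranges over all permutations of $1,\ldots,k$. The rank encoding of $\pi=\pi_1\ldots\pi_n$ is the word $E(\pi)=p_1\ldots p_n$ with $p_i=|\{j\mid j\ge i,\ \pi_j\le\pi_i\}|$; one has $\pi\in\Omega_k$ if and only if $E(\pi)\in[k]^*$, where $[k]=\{1,\ldots,k\}$. A set $S$ of permutations contained in $\Omega_m$ for some $m$ is called regular if $E(S)=\{E(\pi)\mid\pi\in S\}$ is a regular language over $[m]$ (this does not depend on the choice of $m$). If $\mathcal{X}\subseteq\Omega_k$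 is closed then its basis is contained in $\Omega_{k+1}$. "Satisfies a linear recurrence with constant coefficients" means that there are constants $d\ge 0$, $c_1,\ldots,c_d$ with $a_n=c_1a_{n-1}+\cdots+c_da_{n-d}$ for all sufficiently large $n$; equivalently, $\sum_n a_nx^n$ is a rational function. "Membership can be checked in linear time" means that, for the fixed set $\mathcal{X}$, there is an algorithm (on a standard unit-cost random access machine) which, given a permutation $\sigma$ of length $n$, decides whether $\sigma\in\mathcal{X}$ in time $O(n)$. *)

theory Defs
  imports Complex_Main "HOL-Library.Sublist" "HOL-Library.Landau_Symbols"
begin

section \<open>Permutations, involvement, closed sets\<close>

text \<open>
  A permutation of length \<open>n\<close> is the list of its values \<open>\<pi>\<^sub>1, \<dots>, \<pi>\<^sub>n\<close>, so \<open>\<pi>\<^sub>i\<close> is \<open>\<pi> ! (i - 1)\<close>.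
\<close>

definition is_perm :: "nat list \<Rightarrow> bool" where
  "is_perm \<pi> \<longleftrightarrow> distinct \<pi> \<and> set \<pi> = {1..length \<pi>}"

definition order_iso :: "nat list \<Rightarrow> nat list \<Rightarrow> bool" where
  "order_iso xs ys \<longleftrightarrow> length xs = length ys \<and>
     (\<forall>i < length xs. \<forall>j < length xs. xs ! i < xs ! j \<longleftrightarrow> ys ! i < ys ! j)"

definition involved :: "nat list \<Rightarrow> nat list \<Rightarrow> bool"  (infix "\<preceq>" 50) where
  "\<pi> \<preceq> \<sigma> \<longleftrightarrow> (\<exists>ys. subseq ys \<sigma> \<and> order_iso \<pi> ys)"

definition closed_perm_set :: "nat list set \<Rightarrow> bool" where
  "closed_perm_set X \<longleftrightarrow> (\<forall>\<sigma> \<in> X. is_perm \<sigma>) \<and>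
     (\<forall>\<sigma> \<in> X. \<forall>\<pi>. is_perm \<pi> \<and> \<pi> \<preceq> \<sigma> \<longrightarrow> \<pi> \<in> X)"

definition perm_basis :: "nat list set \<Rightarrow> nat list set" where
  "perm_basis X = {\<beta>. is_perm \<beta> \<and> \<beta> \<notin> X \<and>
     (\<forall>\<pi>. is_perm \<pi> \<and> \<pi> \<notin> X \<and> \<pi> \<preceq> \<beta> \<longrightarrow> \<pi> = \<beta>)}"


section \<open>The sets \<open>\<Omega>\<^sub>k\<close>\<close>

definition Omega_basis :: "nat \<Rightarrow> nat list set" where
  "Omega_basis k = {(k + 1) # a | a. is_perm a \<and> length a = k}"

text \<open>
  The closed set with basis \<open>B\<close> consists of the permutations involving no element of \<open>B\<close>; that
  \<open>Omega k\<close> is closed and that its basis is \<open>Omega_basis k\<close> is proved at the end of this theory.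
\<close>

definition Omega :: "nat \<Rightarrow> nat list set" where
  "Omega k = {\<pi>. is_perm \<pi> \<and> (\<forall>\<beta> \<in> Omega_basis k. \<not> \<beta> \<preceq> \<pi>)}"


section \<open>Regular sets of permutations\<close>

definition rank_encoding :: "nat list \<Rightarrow> nat list" where
  "rank_encoding \<pi> =
     map (\<lambda>i. card {j. i \<le> j \<and> j < length \<pi> \<and> \<pi> ! j \<le> \<pi> ! i}) [0..<length \<pi>]"

text \<open>A language over \<open>A\<close> is regular if it is recognised by a deterministic finite automaton.\<close>

definition regular_language :: "'a set \<Rightarrow> 'a list set \<Rightarrow> bool" where
  "regular_language A L \<longleftrightarrow>
     (\<exists>(Q :: nat set) \<delta> q\<^sub>0 F. finite Q \<and> q\<^sub>0 \<in> Q \<and> F \<subseteq> Q \<and>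
        (\<forall>q \<in> Q. \<forall>a \<in> A. \<delta> q a \<in> Q) \<and>
        L = {w \<in> lists A. foldl \<delta> q\<^sub>0 w \<in> F})"

definition regular_perm_set :: "nat list set \<Rightarrow> bool" where
  "regular_perm_set S \<longleftrightarrow>
     (\<exists>m \<ge> 1. S \<subseteq> Omega m \<and> regular_language {1..m} (rank_encoding ` S))"


section \<open>Enumeration\<close>

definition enum_seq :: "nat list set \<Rightarrow> nat \<Rightarrow> nat" where
  "enum_seq X n = card {\<pi> \<in> X. length \<pi> = n}"

definition satisfies_linear_recurrence :: "(nat \<Rightarrow> 'a :: comm_ring_1) \<Rightarrow> bool" where
  "satisfies_linear_recurrence a \<longleftrightarrow>
     (\<exists>(d :: nat) (c :: nat \<Rightarrow> 'a) N. d \<le> N \<and> (\<forall>n \<ge> N. a n = (\<Sum>i = 1..d. c i * a (n - i))))"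


section \<open>Random access machines with unit cost\<close>

text \<open>
  The machine has registers and a memory, both holding arbitrary natural numbers. A program is a
  finite list of instructions and can name only finitely many registers; memory is addressed
  indirectly, through registers. Every instruction costs one step. Arithmetic is limited to
  addition and (truncated) subtraction, because multiplication at unit cost would allow a single
  step to do an unreasonable amount of work.
\<close>

datatype instr =
    Const nat nat        \<comment> \<open>\<open>R[r] := c\<close>\<close>
  | Copy nat nat         \<comment> \<open>\<open>R[r] := R[s]\<close>\<close>
  | Add nat nat nat      \<comment> \<open>\<open>R[r] := R[s] + R[t]\<close>\<close>
  | Sub nat nat nat      \<comment> \<open>\<open>R[r] := R[s] - R[t]\<close>, truncated at 0\<close>
  | Load nat nat         \<comment> \<open>\<open>R[r] := M[R[s]]\<close>\<close>
  | Store nat nat        \<comment> \<open>\<open>M[R[r]] := R[s]\<close>\<close>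
  | Jump nat
  | JumpLess nat nat nat \<comment> \<open>\<open>if R[r] < R[s] then goto l\<close>\<close>
  | Halt bool

record config =
  pc  :: nat
  reg :: "nat \<Rightarrow> nat"
  mem :: "nat \<Rightarrow> nat"

fun exec :: "instr \<Rightarrow> config \<Rightarrow> config" where
  "exec (Const r x) c = c\<lparr>pc := pc c + 1, reg := (reg c)(r := x)\<rparr>"
| "exec (Copy r s) c = c\<lparr>pc := pc c + 1, reg := (reg c)(r := reg c s)\<rparr>"
| "exec (Add r s t) c = c\<lparr>pc := pc c + 1, reg := (reg c)(r := reg c s + reg c t)\<rparr>"
| "exec (Sub r s t) c = c\<lparr>pc := pc c + 1, reg := (reg c)(r := reg c s - reg c t)\<rparr>"
| "exec (Load r s) c = c\<lparr>pc := pc c + 1, reg := (reg c)(r := mem c (reg c s))\<rparr>"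
| "exec (Store r s) c = c\<lparr>pc := pc c + 1, mem := (mem c)(reg c r := reg c s)\<rparr>"
| "exec (Jump l) c = c\<lparr>pc := l\<rparr>"
| "exec (JumpLess r s l) c = c\<lparr>pc := (if reg c r < reg c s then l else pc c + 1)\<rparr>"
| "exec (Halt b) c = c"

text \<open>A machine whose program counter has left the program is stuck and gives no answer.\<close>

definition step :: "instr list \<Rightarrow> config \<Rightarrow> config" where
  "step P c = (if pc c < length P then exec (P ! pc c) c else c)"

definition answers :: "instr list \<Rightarrow> config \<Rightarrow> bool \<Rightarrow> bool" where
  "answers P c b \<longleftrightarrow> pc c < length P \<and> P ! pc c = Halt b"

text \<open>Input \<open>\<sigma>\<close>: its length is in register 0 and \<open>\<sigma>\<^sub>1, \<dots>, \<sigma>\<^sub>n\<close> are in the memory cells \<open>1, \<dots>, n\<close>.\<close>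

definition initial_config :: "nat list \<Rightarrow> config" where
  "initial_config \<sigma> =
     \<lparr>pc = 0,
      reg = (\<lambda>r. if r = 0 then length \<sigma> else 0),
      mem = (\<lambda>i. if 1 \<le> i \<and> i \<le> length \<sigma> then \<sigma> ! (i - 1) else 0)\<rparr>"

definition answers_within :: "instr list \<Rightarrow> nat list \<Rightarrow> nat \<Rightarrow> bool \<Rightarrow> bool" where
  "answers_within P \<sigma> t b \<longleftrightarrow> (\<exists>s \<le> t. answers P ((step P ^^ s) (initial_config \<sigma>)) b)"

definition linear_time_membership :: "nat list set \<Rightarrow> bool" where
  "linear_time_membership X \<longleftrightarrow>
     (\<exists>P (T :: nat \<Rightarrow> nat). (\<lambda>n. real (T n)) \<in> O(\<lambda>n. real n) \<and>
        (\<forall>\<sigma>. is_perm \<sigma> \<longrightarrow> answers_within P \<sigma> (T (length \<sigma>)) (\<sigma> \<in> X)))"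


section \<open>The basis of \<open>\<Omega>\<^sub>k\<close>\<close>

lemma nths_conv_map_nth: "nths xs N = map ((!) xs) (filter (\<lambda>i. i \<in> N) [0..<length xs])"
proof (induction xs rule: rev_induct)
  case (snoc x xs)
  have "map ((!) (xs @ [x])) (filter (\<lambda>i. i \<in> N) [0..<length xs])
      = map ((!) xs) (filter (\<lambda>i. i \<in> N) [0..<length xs])"
    by (rule map_cong) (auto simp: nth_append)
  then show ?case using snoc by (simp add: nths_append)
qed simp

lemma order_iso_nths:
  assumes "order_iso xs ys"
  shows "order_iso (nths xs N) (nths ys N)"
proof -
  let ?is = "filter (\<lambda>i. i \<in> N) [0..<length xs]"
  have len: "length ys = length xs" using assms by (simp add: order_iso_def)
  have lt: "?is ! a < length xs" if "a < length ?is" for a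
    using nth_mem[OF that] by simp
  have "order_iso (map ((!) xs) ?is) (map ((!) ys) ?is)"
    using assms lt unfolding order_iso_def by simp
  then show ?thesis by (simp add: nths_conv_map_nth len)
qed

lemma order_iso_trans: "order_iso xs ys \<Longrightarrow> order_iso ys zs \<Longrightarrow> order_iso xs zs"
  by (auto simp: order_iso_def)

lemma involved_refl: "\<pi> \<preceq> \<pi>"
  by (auto simp: involved_def order_iso_def)

lemma involved_trans:
  assumes "\<pi> \<preceq> \<sigma>" "\<sigma> \<preceq> \<tau>"
  shows "\<pi> \<preceq> \<tau>"
proof -
  from assms obtain ys zs where ys: "subseq ys \<sigma>" "order_iso \<pi> ys"
    and zs: "subseq zs \<tau>" "order_iso \<sigma> zs"
    by (auto simp: involved_def)
  from ys(1) obtain N where N: "ys = nths \<sigma> N" by (auto simp: subseq_conv_nths)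
  have "order_iso \<pi> (nths zs N)"
    using ys(2) order_iso_nths[OF zs(2), of N] order_iso_trans N by blast
  moreover have "subseq (nths zs N) \<tau>"
    using zs(1) by (meson subseq_conv_nths subseq_order.trans)
  ultimately show ?thesis by (auto simp: involved_def)
qed

lemma involved_length: "\<pi> \<preceq> \<sigma> \<Longrightarrow> length \<pi> \<le> length \<sigma>"
  by (auto simp: involved_def order_iso_def dest: list_emb_length)

lemma perm_nth_eq_card:
  assumes "is_perm \<pi>" "i < length \<pi>"
  shows "\<pi> ! i = Suc (card {j. j < length \<pi> \<and> \<pi> ! j < \<pi> ! i})"
proof -
  let ?J = "{j. j < length \<pi> \<and> \<pi> ! j < \<pi> ! i}"
  have d: "distinct \<pi>" and s: "set \<pi> = {1..length \<pi>}" using assms(1) by (auto simp: is_perm_def)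
  have "\<pi> ! i \<in> {1..length \<pi>}" using s assms(2) nth_mem by blast
  moreover have "(!) \<pi> ` ?J = {x \<in> set \<pi>. x < \<pi> ! i}" by (auto simp: in_set_conv_nth)
  ultimately have "(!) \<pi> ` ?J = {1..<\<pi> ! i}" using s by auto
  moreover have "card ((!) \<pi> ` ?J) = card ?J"
    by (rule card_image) (use d in \<open>auto simp: inj_on_def nth_eq_iff_index_eq\<close>)
  ultimately have "card ?J = \<pi> ! i - 1" by simp
  then show ?thesis using \<open>\<pi> ! i \<in> {1..length \<pi>}\<close> by auto
qed

lemma involved_same_length:
  assumes "is_perm \<pi>" "is_perm \<sigma>" "\<pi> \<preceq> \<sigma>" "length \<pi> = length \<sigma>"
  shows "\<pi> = \<sigma>"
proof -
  from assms obtain ys where "subseq ys \<sigma>" "order_iso \<pi> ys" by (auto simp: involved_def)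
  with assms(4) have iso: "order_iso \<pi> \<sigma>"
    by (metis order_iso_def subseq_same_length)
  show ?thesis
  proof (rule nth_equalityI)
    fix i assume i: "i < length \<pi>"
    have "{j. j < length \<pi> \<and> \<pi> ! j < \<pi> ! i} = {j. j < length \<sigma> \<and> \<sigma> ! j < \<sigma> ! i}"
      using iso i by (auto simp: order_iso_def)
    then show "\<pi> ! i = \<sigma> ! i"
      using perm_nth_eq_card[OF assms(1) i] perm_nth_eq_card[of \<sigma> i] assms(2,4) i by simp
  qed fact
qed

lemma is_perm_Omega_basis: "\<beta> \<in> Omega_basis k \<Longrightarrow> is_perm \<beta> \<and> length \<beta> = k + 1"
  by (auto simp: Omega_basis_def is_perm_def)

lemma closed_Omega: "closed_perm_set (Omega k)"
  using involved_trans by (auto simp: closed_perm_set_def Omega_def)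

lemma basis_Omega: "perm_basis (Omega k) = Omega_basis k"
proof (intro set_eqI iffI)
  fix \<beta> assume "\<beta> \<in> perm_basis (Omega k)"
  then obtain \<gamma> where "\<gamma> \<in> Omega_basis k" "\<gamma> \<preceq> \<beta>" and
    min: "\<And>\<pi>. is_perm \<pi> \<Longrightarrow> \<pi> \<notin> Omega k \<Longrightarrow> \<pi> \<preceq> \<beta> \<Longrightarrow> \<pi> = \<beta>"
    by (auto simp: perm_basis_def Omega_def)
  moreover have "is_perm \<gamma>" "\<gamma> \<notin> Omega k"
    using \<open>\<gamma> \<in> Omega_basis k\<close> is_perm_Omega_basis involved_refl by (auto simp: Omega_def)
  ultimately show "\<beta> \<in> Omega_basis k" by blast
next
  fix \<beta> assume \<beta>: "\<beta> \<in> Omega_basis k"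
  have "\<pi> = \<beta>" if "is_perm \<pi>" "\<pi> \<notin> Omega k" "\<pi> \<preceq> \<beta>" for \<pi>
  proof -
    from that obtain \<gamma> where "\<gamma> \<in> Omega_basis k" "\<gamma> \<preceq> \<pi>" by (auto simp: Omega_def)
    then have "length \<beta> \<le> length \<pi>"
      using \<beta> is_perm_Omega_basis involved_length by metis
    then show ?thesis
      using that \<beta> is_perm_Omega_basis involved_length involved_same_length by (meson le_antisym)
  qed
  then show "\<beta> \<in> perm_basis (Omega k)"
    using \<beta> is_perm_Omega_basis[OF \<beta>] involved_refl[of \<beta>]
    unfolding perm_basis_def Omega_def by blast
qed

end

theory Submission
  imports Defs "HOL-Library.Function_Algebras"
begin

text \<open>
  Everything is done with rank encodings. Two lists of distinct numbers are order isomorphic if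
  and only if they have the same encoding (\<open>order_iso_imp_rank_encoding_eq\<close>,
  \<open>rank_encoding_eq_imp_order_iso\<close>), so a permutation \<open>\<pi>\<close> involves an element of a set \<open>B\<close> if and
  only if some subsequence of \<open>\<pi>\<close> has its encoding in the language of \<open>B\<close>. Moreover, \<open>\<pi>\<close> lies in
  \<open>Omega k\<close> if and only if its encoding has no letter above \<open>k\<close>.

  The key point is that, for encodings over \<open>{1..k}\<close>, deleting entries is a finite-state operation
  when it is performed from right to left. The rank of an entry in the subsequence is found by
  counting the kept ones among the lower later entries. There are fewer than \<open>k\<close> of these, so it
  suffices to remember for each of the \<open>k\<close> lowest values seen so far whether it is kept
  (\<open>marks\<close>, \<open>erase\<close>, \<open>rank_encoding_keep\<close>). Tracking all choices of deletions at once, together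
  with the left quotient of the regular language by the word produced so far, gives a
  deterministic finite automaton that tells whether a permutation in \<open>Omega k\<close> involves an element
  of \<open>B\<close> (\<open>deletion_automaton\<close>). With the basis of \<open>X\<close> for \<open>B\<close>, this automaton decides membership
  in \<open>X\<close> (\<open>closed_set_automaton\<close>).

  Both claims follow from the automaton. The encoding is a bijection from permutations to words in
  which no letter exceeds the number of letters from there on. From length \<open>k\<close> on, prefixing any
  letter of \<open>{1..k}\<close> respects this condition, so the numbers of words that lead to the individual
  states develop by multiplication with a fixed matrix, and a linear recurrence results from a
  linear dependence between the vectors of these numbers (\<open>automaton_linear_recurrence\<close>).
  For the linear time bound, a machine scans the permutation from right to left and keeps the \<open>k\<close>
  lowest values in registers. It thus finds each rank, or rejects because the rank exceeds \<open>k\<close>, in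
  a bounded number of steps, and it runs the automaton in its program counter
  (\<open>program_halts\<close>, in the locale \<open>rank_machine\<close>).
\<close>

section \<open>Rank encodings and order isomorphism\<close>

abbreviation count_le :: "nat \<Rightarrow> nat list \<Rightarrow> nat" where
  "count_le t xs \<equiv> length (filter (\<lambda>y. y \<le> t) xs)"

lemma length_rank_encoding [simp]: "length (rank_encoding xs) = length xs"
  by (simp add: rank_encoding_def)

lemma rank_encoding_Nil [simp]: "rank_encoding [] = []"
  by (simp add: rank_encoding_def)

lemma rank_encoding_Cons [simp]:
  "rank_encoding (x # xs) = Suc (count_le x xs) # rank_encoding xs"
proof -
  let ?n = "length xs"
  have "{j. 0 \<le> j \<and> j < Suc ?n \<and> (x # xs) ! j \<le> x} = insert 0 (Suc ` {j. j < ?n \<and> xs ! j \<le> x})"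
    by (intro set_eqI, rename_tac j, case_tac j) auto
  then have head: "card {j. 0 \<le> j \<and> j < Suc ?n \<and> (x # xs) ! j \<le> x} = Suc (count_le x xs)"
    by (simp add: card_image length_filter_conv_card)
  have tail: "card {j. Suc i \<le> j \<and> j < Suc ?n \<and> (x # xs) ! j \<le> xs ! i}
      = card {j. i \<le> j \<and> j < ?n \<and> xs ! j \<le> xs ! i}" for i
  proof -
    have "{j. Suc i \<le> j \<and> j < Suc ?n \<and> (x # xs) ! j \<le> xs ! i}
        = Suc ` {j. i \<le> j \<and> j < ?n \<and> xs ! j \<le> xs ! i}"
      by (rule set_eqI, rename_tac j, case_tac j) auto
    then show ?thesis by (simp add: card_image)
  qed
  have "[0..<Suc ?n] = 0 # map Suc [0..<?n]"
    by (simp only: map_Suc_upt upt_conv_Cons[OF zero_less_Suc])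
  then show ?thesis
    using head tail by (simp add: rank_encoding_def del: upt_Suc)
qed

lemma rank_encoding_drop: "rank_encoding (drop i xs) = drop i (rank_encoding xs)"
proof (induction xs arbitrary: i)
  case (Cons x xs)
  then show ?case by (cases i) auto
qed simp

lemma order_iso_imp_rank_encoding_eq:
  assumes "order_iso xs ys"
  shows "rank_encoding xs = rank_encoding ys"
proof -
  have len: "length ys = length xs" using assms by (simp add: order_iso_def)
  have "xs ! j \<le> xs ! i \<longleftrightarrow> ys ! j \<le> ys ! i" if "i < length xs" "j < length xs" for i j
    using assms that by (metis order_iso_def not_less)
  then have "{j. i \<le> j \<and> j < length xs \<and> xs ! j \<le> xs ! i}
      = {j. i \<le> j \<and> j < length xs \<and> ys ! j \<le> ys ! i}" if "i < length xs" for i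
    using that by blast
  then show ?thesis
    by (simp add: rank_encoding_def len cong: map_cong)
qed

lemma order_iso_Cons_iff:
  "order_iso (x # xs) (y # ys) \<longleftrightarrow> order_iso xs ys \<and>
     (\<forall>j < length xs. (xs ! j < x \<longleftrightarrow> ys ! j < y) \<and> (x < xs ! j \<longleftrightarrow> y < ys ! j))"
  by (auto simp: order_iso_def All_less_Suc2)

text \<open>
  Two lists with order isomorphic tails give the same linear order on the positions of the tails.
  The positions with a value not exceeding the head form an initial segment of that order, and an
  initial segment is determined by its size, which is the first letter of the encoding.
\<close>

lemma rank_encoding_eq_imp_order_iso:
  assumes "distinct xs" "distinct ys" "rank_encoding xs = rank_encoding ys"
  shows "order_iso xs ys"
proof -
  have "length xs = length ys" by (metis assms(3) length_rank_encoding)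
  then show ?thesis
    using assms
  proof (induction xs ys rule: list_induct2)
    case Nil
    then show ?case by (simp add: order_iso_def)
  next
    case (Cons x xs y ys)
    then have iso: "order_iso xs ys" and len: "length xs = length ys" by auto
    let ?A = "{j. j < length xs \<and> xs ! j \<le> x}" and ?B = "{j. j < length xs \<and> ys ! j \<le> y}"
    have card: "card ?A = card ?B"
      using Cons.prems(3) len by (simp add: length_filter_conv_card)
    \<comment> \<open>Initial segments of the same linear order are comparable.\<close>
    have "?A \<subseteq> ?B \<or> ?B \<subseteq> ?A"
    proof (rule ccontr)
      assume "\<not> (?A \<subseteq> ?B \<or> ?B \<subseteq> ?A)"
      then obtain i j where "i < length xs" "j < length xs"
        "xs ! i \<le> x" "\<not> ys ! i \<le> y" "ys ! j \<le> y" "\<not> xs ! j \<le> x" by blast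
      then have "xs ! i < xs ! j" "\<not> ys ! i < ys ! j" by auto
      with iso \<open>i < length xs\<close> \<open>j < length xs\<close> show False by (auto simp: order_iso_def)
    qed
    then have AB: "?A = ?B"
    proof
      assume "?A \<subseteq> ?B"
      then show ?thesis by (rule card_subset_eq[OF _ _ card, rotated]) simp
    next
      assume "?B \<subseteq> ?A"
      then show ?thesis by (rule card_subset_eq[OF _ _ card[symmetric], rotated, symmetric]) simp
    qed
    have ne: "xs ! j \<noteq> x \<and> ys ! j \<noteq> y" if "j < length xs" for j
      using Cons.prems(1,2) that len by (metis distinct.simps(2) nth_mem)
    show ?case
      unfolding order_iso_Cons_iff
    proof (intro conjI allI impI iso)
      fix j assume j: "j < length xs"
      then have "xs ! j \<le> x \<longleftrightarrow> ys ! j \<le> y" using AB by blast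
      then show "xs ! j < x \<longleftrightarrow> ys ! j < y" "x < xs ! j \<longleftrightarrow> y < ys ! j"
        using ne[OF j] by auto
    qed
  qed
qed

text \<open>
  These words are exactly the rank encodings of permutations, because the only restriction on the
  rank of an entry is the number of entries from there on. The nontrivial direction is
  \<open>rank_word_imp_perm\<close>.
\<close>

fun rank_word :: "nat list \<Rightarrow> bool" where
  "rank_word [] \<longleftrightarrow> True"
| "rank_word (p # w) \<longleftrightarrow> 1 \<le> p \<and> p \<le> Suc (length w) \<and> rank_word w"

lemma rank_word_rank_encoding: "rank_word (rank_encoding xs)"
  by (induction xs) auto

lemma count_le_perm:
  assumes "is_perm \<pi>" "p \<le> length \<pi>"
  shows "count_le p \<pi> = p"
proof -
  have "count_le p \<pi> = card (set (filter (\<lambda>y. y \<le> p) \<pi>))"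
    using assms(1) by (simp add: is_perm_def distinct_card del: set_filter)
  also have "set (filter (\<lambda>y. y \<le> p) \<pi>) = {1..p}"
    using assms by (auto simp: is_perm_def)
  finally show ?thesis by simp
qed

text \<open>
  A first entry of rank \<open>p\<close> is added to a permutation by raising all values from \<open>p\<close> on by one,
  which makes room for the value \<open>p\<close> and keeps the relative order of the later entries.
\<close>

lemma rank_word_imp_perm:
  assumes "rank_word w"
  obtains \<pi> where "is_perm \<pi>" "rank_encoding \<pi> = w"
  using assms
proof (induction w arbitrary: thesis)
  case Nil
  show ?case by (rule Nil.prems(1)[of "[]"]) (simp_all add: is_perm_def)
next
  case (Cons p w)
  obtain \<pi> where \<pi>: "is_perm \<pi>" "rank_encoding \<pi> = w"
    using Cons.IH Cons.prems(2) by auto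
  have len: "length \<pi> = length w" using \<pi>(2) by auto
  have p: "1 \<le> p" "p \<le> Suc (length \<pi>)" using Cons.prems(2) len by auto
  define up where "up = (\<lambda>y. if y < p then y else Suc y)"
  have inj: "inj up" by (auto simp: inj_on_def up_def split: if_splits)
  have img: "insert p (up ` {1..length \<pi>}) = {1..Suc (length \<pi>)}"
  proof
    show "insert p (up ` {1..length \<pi>}) \<subseteq> {1..Suc (length \<pi>)}"
      using p by (auto simp: up_def)
    show "{1..Suc (length \<pi>)} \<subseteq> insert p (up ` {1..length \<pi>})"
    proof
      fix y assume y: "y \<in> {1..Suc (length \<pi>)}"
      consider "y < p" | "y = p" | "p < y" by linarith
      then show "y \<in> insert p (up ` {1..length \<pi>})"
      proof cases
        case 1
        then have "y = up y" "y \<in> {1..length \<pi>}" using y p by (auto simp: up_def)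
        then show ?thesis by blast
      next
        case 3
        then have "y = up (y - 1)" "y - 1 \<in> {1..length \<pi>}" using y p by (auto simp: up_def)
        then show ?thesis by blast
      qed simp
    qed
  qed
  have perm: "is_perm (p # map up \<pi>)"
    unfolding is_perm_def
  proof
    have "p \<notin> range up" by (auto simp: up_def)
    then show "distinct (p # map up \<pi>)"
      using \<pi>(1) inj by (auto simp: is_perm_def distinct_map intro: inj_on_subset)
    show "set (p # map up \<pi>) = {1..length (p # map up \<pi>)}"
      using \<pi>(1) img by (simp add: is_perm_def)
  qed
  have "order_iso \<pi> (map up \<pi>)"
    by (auto simp: order_iso_def up_def)
  then have tail: "rank_encoding (map up \<pi>) = w"
    using order_iso_imp_rank_encoding_eq \<pi>(2) by metis
  have "count_le p (map up \<pi>) = count_le (p - 1) \<pi>"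
    unfolding filter_map length_map using p(1)
    by (intro arg_cong[where f = length] filter_cong) (auto simp: up_def)
  also have "\<dots> = p - 1"
    using count_le_perm[OF \<pi>(1)] p by simp
  finally have "rank_encoding (p # map up \<pi>) = p # w"
    using tail p by simp
  with perm show ?case by (rule Cons.prems(1))
qed

lemma standardization:
  assumes "distinct ys"
  obtains \<pi> where "is_perm \<pi>" "order_iso \<pi> ys"
proof -
  obtain \<pi> where "is_perm \<pi>" "rank_encoding \<pi> = rank_encoding ys"
    using rank_word_imp_perm[OF rank_word_rank_encoding] by metis
  then show ?thesis
    using that rank_encoding_eq_imp_order_iso[of \<pi> ys] assms by (auto simp: is_perm_def)
qed

lemma inj_on_rank_encoding: "inj_on rank_encoding {\<pi>. is_perm \<pi>}"
proof (rule inj_onI)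
  fix \<pi> \<sigma> assume "\<pi> \<in> {\<pi>. is_perm \<pi>}" "\<sigma> \<in> {\<pi>. is_perm \<pi>}"
    and eq: "rank_encoding \<pi> = rank_encoding \<sigma>"
  then have perms: "is_perm \<pi>" "is_perm \<sigma>" by auto
  then have iso: "order_iso \<pi> \<sigma>"
    using eq rank_encoding_eq_imp_order_iso by (auto simp: is_perm_def)
  then have "\<pi> \<preceq> \<sigma>" "length \<pi> = length \<sigma>"
    by (auto simp: involved_def order_iso_def)
  with perms show "\<pi> = \<sigma>" by (intro involved_same_length)
qed

text \<open>
  Involvement thus becomes a property of words, provided that the encoding of a subsequence can be
  computed from the encoding of the whole.
\<close>

lemma involved_iff_rank_encoding:
  assumes "is_perm \<pi>" "distinct \<sigma>"
  shows "\<pi> \<preceq> \<sigma> \<longleftrightarrow> (\<exists>ys. subseq ys \<sigma> \<and> rank_encoding ys = rank_encoding \<pi>)"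
proof -
  have "distinct ys" if "subseq ys \<sigma>" for ys
    using that assms(2) by (metis distinct_nthsI subseq_conv_nths)
  then show ?thesis
    using assms(1) order_iso_imp_rank_encoding_eq rank_encoding_eq_imp_order_iso
    unfolding involved_def is_perm_def by metis
qed

section \<open>Closed sets in terms of rank encodings\<close>

text \<open>
  A letter above \<open>k\<close> belongs to an entry with at least \<open>k\<close> later entries not above it. In a
  permutation, together with \<open>k\<close> of them it forms a subsequence that is order isomorphic to an element of \<open>Omega_basis k\<close>.
\<close>

lemma large_rank_iff:
  "\<not> set (rank_encoding xs) \<subseteq> {1..k} \<longleftrightarrow>
     (\<exists>y ys. subseq (y # ys) xs \<and> length ys = k \<and> (\<forall>z \<in> set ys. z \<le> y))"
proof (induction xs)
  case (Cons x xs)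
  have "k \<le> count_le x xs \<longleftrightarrow> (\<exists>ys. subseq ys xs \<and> length ys = k \<and> (\<forall>z \<in> set ys. z \<le> x))"
  proof
    assume le: "k \<le> count_le x xs"
    let ?ys = "take k (filter (\<lambda>y. y \<le> x) xs)"
    have "subseq ?ys xs"
      by (meson subseq_filter_left subseq_order.trans take_is_prefix prefix_imp_subseq)
    moreover have "length ?ys = k" "\<forall>z \<in> set ?ys. z \<le> x"
      using le by (auto dest!: in_set_takeD)
    ultimately show "\<exists>ys. subseq ys xs \<and> length ys = k \<and> (\<forall>z \<in> set ys. z \<le> x)" by blast
  next
    assume "\<exists>ys. subseq ys xs \<and> length ys = k \<and> (\<forall>z \<in> set ys. z \<le> x)"
    then obtain ys where ys: "subseq ys xs" "length ys = k" "\<forall>z \<in> set ys. z \<le> x" by blast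
    then have "subseq (filter (\<lambda>y. y \<le> x) ys) (filter (\<lambda>y. y \<le> x) xs)" by (intro subseq_filter)
    then show "k \<le> count_le x xs" using ys(2,3) by (auto dest: list_emb_length)
  qed
  moreover have "(\<exists>y ys. subseq (y # ys) (x # xs) \<and> length ys = k \<and> (\<forall>z \<in> set ys. z \<le> y)) \<longleftrightarrow>
      (\<exists>ys. subseq ys xs \<and> length ys = k \<and> (\<forall>z \<in> set ys. z \<le> x)) \<or>
      (\<exists>y ys. subseq (y # ys) xs \<and> length ys = k \<and> (\<forall>z \<in> set ys. z \<le> y))"
    (is "?L \<longleftrightarrow> ?R")
  proof
    show "?L \<Longrightarrow> ?R" by (force simp: subseq_Cons2_iff split: if_splits)
    show "?R \<Longrightarrow> ?L" by (blast intro: list_emb.list_emb_Cons list_emb.list_emb_Cons2)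
  qed
  moreover have "\<not> set (rank_encoding (x # xs)) \<subseteq> {1..k} \<longleftrightarrow>
      k \<le> count_le x xs \<or> \<not> set (rank_encoding xs) \<subseteq> {1..k}"
    by (auto simp: not_le less_Suc_eq_le Suc_le_eq)
  ultimately show ?case using Cons.IH by blast
qed simp

lemma Omega_iff_rank_encoding:
  assumes "is_perm \<pi>"
  shows "\<pi> \<in> Omega k \<longleftrightarrow> set (rank_encoding \<pi>) \<subseteq> {1..k}"
proof -
  have dist: "distinct zs" if "subseq zs \<pi>" for zs
    using that assms by (metis distinct_nthsI is_perm_def subseq_conv_nths)
  have "(\<exists>\<beta> \<in> Omega_basis k. \<beta> \<preceq> \<pi>) \<longleftrightarrow>
      (\<exists>y ys. subseq (y # ys) \<pi> \<and> length ys = k \<and> (\<forall>z \<in> set ys. z \<le> y))"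
  proof
    assume "\<exists>\<beta> \<in> Omega_basis k. \<beta> \<preceq> \<pi>"
    then obtain a zs where a: "is_perm a" "length a = k"
      and zs: "subseq zs \<pi>" "order_iso ((k + 1) # a) zs"
      by (auto simp: Omega_basis_def involved_def)
    from zs(2) obtain y ys where zs_eq: "zs = y # ys" by (cases zs) (auto simp: order_iso_def)
    have len: "length ys = k" using zs(2) a(2) by (simp add: zs_eq order_iso_def)
    have "a ! j < k + 1" if "j < k" for j
      using a that nth_mem[of j a] by (auto simp: is_perm_def)
    then have "\<forall>j < k. ys ! j < y"
      using zs(2) a(2) unfolding zs_eq order_iso_Cons_iff by auto
    then have "\<forall>z \<in> set ys. z \<le> y" using len by (metis in_set_conv_nth less_imp_le)
    with zs(1) zs_eq len
    show "\<exists>y ys. subseq (y # ys) \<pi> \<and> length ys = k \<and> (\<forall>z \<in> set ys. z \<le> y)" by blast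
  next
    assume "\<exists>y ys. subseq (y # ys) \<pi> \<and> length ys = k \<and> (\<forall>z \<in> set ys. z \<le> y)"
    then obtain y ys where ys: "subseq (y # ys) \<pi>" "length ys = k" "\<forall>z \<in> set ys. z \<le> y" by blast
    have d: "distinct (y # ys)" by (rule dist[OF ys(1)])
    obtain a where a: "is_perm a" "order_iso a ys" using standardization d by auto
    have len: "length a = k" using a(2) ys(2) by (simp add: order_iso_def)
    have "a ! j < k + 1" "ys ! j < y" if "j < k" for j
      using a(1) len ys(2,3) d that nth_mem[of j a] nth_mem[of j ys]
      by (auto simp: is_perm_def order_le_less)
    then have "order_iso ((k + 1) # a) (y # ys)"
      using a(2) len unfolding order_iso_Cons_iff by (metis less_asym)
    then show "\<exists>\<beta> \<in> Omega_basis k. \<beta> \<preceq> \<pi>"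
      using ys(1) a(1) len by (force simp: Omega_basis_def involved_def)
  qed
  moreover have "\<pi> \<in> Omega k \<longleftrightarrow> \<not> (\<exists>\<beta> \<in> Omega_basis k. \<beta> \<preceq> \<pi>)"
    using assms by (simp add: Omega_def)
  ultimately show ?thesis
    by (simp only: large_rank_iff[symmetric] not_not)
qed

text \<open>
  Among the permutations outside \<open>X\<close> that are involved in \<open>\<pi>\<close>, one of least length is an element
  of the basis, because a proper involvement decreases the length.
\<close>

lemma closed_iff_avoids_basis:
  assumes "closed_perm_set X" "is_perm \<pi>"
  shows "\<pi> \<in> X \<longleftrightarrow> \<not> (\<exists>\<beta> \<in> perm_basis X. \<beta> \<preceq> \<pi>)"
proof
  assume "\<pi> \<in> X"
  with assms(1) show "\<not> (\<exists>\<beta> \<in> perm_basis X. \<beta> \<preceq> \<pi>)"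
    unfolding closed_perm_set_def perm_basis_def by blast
next
  assume avoid: "\<not> (\<exists>\<beta> \<in> perm_basis X. \<beta> \<preceq> \<pi>)"
  show "\<pi> \<in> X"
  proof (rule ccontr)
    assume "\<pi> \<notin> X"
    let ?bad = "\<lambda>\<beta>. is_perm \<beta> \<and> \<beta> \<notin> X \<and> \<beta> \<preceq> \<pi>"
    have "?bad \<pi>" using assms(2) \<open>\<pi> \<notin> X\<close> involved_refl by blast
    then obtain \<beta> where \<beta>: "?bad \<beta>" and min: "\<And>\<gamma>. ?bad \<gamma> \<Longrightarrow> length \<beta> \<le> length \<gamma>"
      using ex_has_least_nat[of ?bad \<pi> length] by blast
    have "\<gamma> = \<beta>" if "is_perm \<gamma>" "\<gamma> \<notin> X" "\<gamma> \<preceq> \<beta>" for \<gamma>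
      using that \<beta> min[of \<gamma>] involved_trans involved_length involved_same_length
      by (meson le_antisym)
    then have "\<beta> \<in> perm_basis X" using \<beta> by (auto simp: perm_basis_def)
    with avoid \<beta> show False by blast
  qed
qed

section \<open>Rank encodings of subsequences\<close>

definition insert_at :: "nat \<Rightarrow> 'a \<Rightarrow> 'a list \<Rightarrow> 'a list" where
  "insert_at i x xs = take i xs @ x # drop i xs"

lemma nth_insert_at:
  assumes "i \<le> length xs" "j \<le> length xs"
  shows "insert_at i x xs ! j = (if j < i then xs ! j else if j = i then x else xs ! (j - 1))"
  using assms by (auto simp: insert_at_def nth_append min_def nth_Cons' not_less)

lemma length_insert_at [simp]: "length (insert_at i x xs) = Suc (length xs)"
  by (simp add: insert_at_def)

lemma set_insert_at [simp]: "set (insert_at i x xs) = insert x (set xs)"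
  by (metis insert_at_def append_take_drop_id set_append list.simps(15) Un_insert_right)

lemma distinct_insert_at [simp]: "distinct (insert_at i x xs) \<longleftrightarrow> x \<notin> set xs \<and> distinct xs"
proof -
  have "distinct (ys @ x # zs) \<longleftrightarrow> x \<notin> set (ys @ zs) \<and> distinct (ys @ zs)" for ys zs
    by auto
  from this[of "take i xs" "drop i xs"] show ?thesis
    by (simp only: insert_at_def append_take_drop_id)
qed

fun keep :: "bool list \<Rightarrow> 'a list \<Rightarrow> 'a list" where
  "keep (b # bs) (x # xs) = (if b then x # keep bs xs else keep bs xs)"
| "keep _ _ = []"

text \<open>
  Let \<open>w\<close> be the encoding of a list \<open>xs\<close> of distinct numbers, and let \<open>bs\<close> say which entries of \<open>xs\<close> are kept. Then
  \<open>marks bs w\<close> is the same information sorted by value: its \<open>i\<close>-th member tells whether the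
  \<open>i\<close>-th lowest entry is kept. Prefixing an entry of rank \<open>p\<close> shifts the marks of the larger values
  by one place.
\<close>

fun marks :: "bool list \<Rightarrow> nat list \<Rightarrow> bool list" where
  "marks (b # bs) (p # w) = insert_at (p - 1) b (marks bs w)"
| "marks _ _ = []"

text \<open>
  The effect of deleting entries on the encoding: the rank of an entry that stays is one more than
  the number of lower later entries that stay, and the marks of the lower later entries are the
  first \<open>p - 1\<close> ones.
\<close>

fun erase :: "bool list \<Rightarrow> nat list \<Rightarrow> nat list" where
  "erase (b # bs) (p # w) =
     (if b then Suc (length (filter id (take (p - 1) (marks bs w)))) # erase bs w else erase bs w)"
| "erase _ _ = []"

lemma subseq_iff_keep: "subseq ys xs \<longleftrightarrow> (\<exists>bs. length bs = length xs \<and> ys = keep bs xs)"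
proof
  show "subseq ys xs \<Longrightarrow> \<exists>bs. length bs = length xs \<and> ys = keep bs xs"
  proof (induction rule: list_emb.induct)
    case (list_emb_Nil ys)
    have "keep (replicate (length ys) False) ys = []" by (induction ys) auto
    then show ?case by (metis length_replicate)
  next
    case (list_emb_Cons xs ys y)
    then obtain bs where "length bs = length ys" "xs = keep bs ys" by blast
    then show ?case by (intro exI[of _ "False # bs"]) simp
  next
    case (list_emb_Cons2 x y xs ys)
    then obtain bs where "length bs = length ys" "xs = keep bs ys" by blast
    then show ?case using list_emb_Cons2.hyps(1) by (intro exI[of _ "True # bs"]) simp
  qed
next
  have "length bs = length xs \<Longrightarrow> subseq (keep bs xs) xs" for bs
    by (induction bs xs rule: list_induct2) auto
  then show "\<exists>bs. length bs = length xs \<and> ys = keep bs xs \<Longrightarrow> subseq ys xs" by blast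
qed

lemma length_marks: "length bs = length w \<Longrightarrow> length (marks bs w) = length w"
  by (induction bs w rule: list_induct2) (auto simp: insert_at_def)

lemma count_le_mono: "s \<le> t \<Longrightarrow> count_le s xs \<le> count_le t xs"
  by (induction xs) auto

text \<open>
  To find a rank, this is applied with the value of the preceding entry as the threshold \<open>t\<close>. In the
  induction, a prefixed entry with value at most \<open>t\<close> contributes its mark to the first part of the
  list, whereas one with value above \<open>t\<close> is placed behind that part.
\<close>

lemma count_marks:
  "length bs = length xs \<Longrightarrow>
     length (filter id (take (count_le t xs) (marks bs (rank_encoding xs)))) = count_le t (keep bs xs)"
proof (induction bs xs rule: list_induct2)
  case (Cons b bs x xs)
  let ?l = "marks bs (rank_encoding xs)" and ?p = "count_le x xs" and ?m = "count_le t xs"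
  have len: "length ?l = length xs" using Cons.hyps by (simp add: length_marks)
  have p: "?p \<le> length ?l" unfolding len by simp
  show ?case
  proof (cases "x \<le> t")
    case True
    then have "?p \<le> ?m" by (rule count_le_mono)
    then have "take ?m ?l = take ?p ?l @ take (?m - ?p) (drop ?p ?l)"
      by (metis le_add_diff_inverse take_add)
    moreover have "take (Suc ?m) (insert_at ?p b ?l) = take ?p ?l @ b # take (?m - ?p) (drop ?p ?l)"
      using p \<open>?p \<le> ?m\<close> by (simp add: insert_at_def min_absorb2 Suc_diff_le)
    ultimately show ?thesis using Cons.IH True by auto
  next
    case False
    then have "?m \<le> ?p" by (intro count_le_mono) simp
    then have "take ?m (insert_at ?p b ?l) = take ?m ?l"
      using p by (simp add: insert_at_def min_absorb1)
    then show ?thesis using Cons.IH False by simp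
  qed
qed simp

lemma rank_encoding_keep:
  "length bs = length xs \<Longrightarrow> rank_encoding (keep bs xs) = erase bs (rank_encoding xs)"
  by (induction bs xs rule: list_induct2) (auto simp: count_marks)

section \<open>Regular languages and quotients\<close>

definition left_quotient :: "'a list set \<Rightarrow> 'a list \<Rightarrow> 'a list set" where
  "left_quotient L u = {v. v @ u \<in> L}"

definition right_quotient :: "'a list set \<Rightarrow> 'a list \<Rightarrow> 'a list set" where
  "right_quotient L u = {v. u @ v \<in> L}"

lemma foldl_closed:
  assumes "\<forall>q \<in> Q. \<forall>a \<in> A. \<delta> q a \<in> Q" "q \<in> Q" "w \<in> lists A"
  shows "foldl \<delta> q w \<in> Q"
  using assms(3,2) by (induction w arbitrary: q) (auto simp: assms(1))

text \<open>
  A rank depends on the later entries only, so encodings are processed from right to left. What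
  matters about a suffix \<open>u\<close> is then its left quotient. It is determined by the set of states from
  which \<open>u\<close> leads to acceptance, unless \<open>u\<close> leaves the alphabet, when it is empty.
\<close>

lemma finite_left_quotients:
  assumes "regular_language A L"
  shows "finite (range (left_quotient L))"
proof -
  obtain Q :: "nat set" and \<delta> q0 F where Q: "finite Q" "q0 \<in> Q" "\<forall>q \<in> Q. \<forall>a \<in> A. \<delta> q a \<in> Q"
    and L: "L = {w \<in> lists A. foldl \<delta> q0 w \<in> F}"
    using assms unfolding regular_language_def by blast
  define G where "G = (\<lambda>R. {v \<in> lists A. foldl \<delta> q0 v \<in> R})"
  have "left_quotient L u \<in> insert {} (G ` Pow Q)" for u
  proof (cases "u \<in> lists A")
    case True
    have "left_quotient L u = G {q \<in> Q. foldl \<delta> q u \<in> F}"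
      using True foldl_closed[OF Q(3,2)] unfolding left_quotient_def G_def L by auto
    then show ?thesis by blast
  next
    case False
    then have "left_quotient L u = {}" by (auto simp: left_quotient_def L)
    then show ?thesis by blast
  qed
  then have "range (left_quotient L) \<subseteq> insert {} (G ` Pow Q)" by blast
  then show ?thesis by (rule finite_subset) (use Q(1) in simp)
qed

text \<open>
  The automaton of Myhill and Nerode. Its states are numbered through an injection, since
  \<open>regular_language\<close> speaks of automata whose states are natural numbers.
\<close>

lemma regular_language_if_finite_right_quotients:
  assumes "finite (range (right_quotient L))" "L \<subseteq> lists A"
  shows "regular_language A L"
proof -
  obtain f :: "'a list set \<Rightarrow> nat" where f: "inj_on f (range (right_quotient L))"
    using assms(1) finite_imp_inj_to_nat_seg by metis
  let ?q = "\<lambda>u. f (right_quotient L u)"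
  define \<delta> where "\<delta> = (\<lambda>q a. f {v. a # v \<in> the_inv_into (range (right_quotient L)) f q})"
  have \<delta>: "\<delta> (?q u) a = ?q (u @ [a])" for u a
    using the_inv_into_f_f[OF f, of "right_quotient L u"]
    by (simp add: \<delta>_def right_quotient_def)
  have run: "foldl \<delta> (?q u) w = ?q (u @ w)" for u w
    by (induction w arbitrary: u) (simp_all add: \<delta>)
  have accept: "?q w \<in> ?q ` L \<longleftrightarrow> w \<in> L" for w
  proof
    assume "?q w \<in> ?q ` L"
    then obtain u where "u \<in> L" "right_quotient L w = right_quotient L u"
      using f by (auto dest: inj_onD)
    moreover from this have "[] \<in> right_quotient L u" by (simp add: right_quotient_def)
    ultimately have "[] \<in> right_quotient L w" by simp
    then show "w \<in> L" by (simp add: right_quotient_def)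
  qed simp
  have "L = {w \<in> lists A. foldl \<delta> (?q []) w \<in> ?q ` L}"
    using assms(2) by (auto simp: run accept)
  moreover have "finite (range ?q)" using assms(1) by (simp add: image_image[symmetric])
  moreover have "\<forall>q \<in> range ?q. \<forall>a \<in> A. \<delta> q a \<in> range ?q" by (auto simp: \<delta>)
  ultimately show ?thesis
    unfolding regular_language_def by (intro exI[of _ "range ?q"] exI[of _ \<delta>] exI[of _ "?q []"] exI[of _ "?q ` L"]) auto
qed

text \<open>
  The right quotients of a finite language consist of suffixes of its words.
\<close>

lemma finite_language_regular:
  assumes "finite L" "L \<subseteq> lists A"
  shows "regular_language A L"
proof (rule regular_language_if_finite_right_quotients[OF _ assms(2)])
  have "right_quotient L u \<in> Pow ((\<lambda>(n, w). drop n w) ` ({..Max (length ` L)} \<times> L))" for u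
  proof -
    have "v \<in> (\<lambda>(n, w). drop n w) ` ({..Max (length ` L)} \<times> L)" if "u @ v \<in> L" for v
    proof -
      have "length (u @ v) \<le> Max (length ` L)"
        using that assms(1) by (intro Max_ge finite_imageI imageI)
      then have "length u \<le> Max (length ` L)" by simp
      moreover have "v = drop (length u) (u @ v)" by simp
      ultimately show ?thesis using that by (intro image_eqI[of _ _ "(length u, u @ v)"]) auto
    qed
    then show ?thesis by (auto simp: right_quotient_def)
  qed
  then have "range (right_quotient L) \<subseteq> Pow ((\<lambda>(n, w). drop n w) ` ({..Max (length ` L)} \<times> L))"
    by blast
  then show "finite (range (right_quotient L))"
    by (rule finite_subset) (use assms(1) in simp)
qed

text \<open>
  A permutation of length at most \<open>m\<close> lies in \<open>Omega m\<close>, because the basis elements of \<open>Omega m\<close>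
  have length \<open>m + 1\<close>.
\<close>

lemma finite_imp_regular_perm_set:
  assumes "finite B" "\<And>\<beta>. \<beta> \<in> B \<Longrightarrow> is_perm \<beta>"
  shows "regular_perm_set B"
proof -
  let ?m = "Suc (Max (insert 0 (length ` B)))"
  have sub: "B \<subseteq> Omega ?m"
  proof
    fix \<beta> assume \<beta>: "\<beta> \<in> B"
    then have "length \<beta> \<le> Max (insert 0 (length ` B))"
      using assms(1) by (intro Max_ge) auto
    then have "\<not> \<gamma> \<preceq> \<beta>" if "\<gamma> \<in> Omega_basis ?m" for \<gamma>
      using that is_perm_Omega_basis[of \<gamma>] involved_length[of \<gamma> \<beta>] by auto
    then show "\<beta> \<in> Omega ?m" using assms(2)[OF \<beta>] by (auto simp: Omega_def)
  qed
  then have "rank_encoding ` B \<subseteq> lists {1..?m}"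
    using assms(2) Omega_iff_rank_encoding[of _ ?m] by blast
  then have "regular_language {1..?m} (rank_encoding ` B)"
    using assms(1) by (intro finite_language_regular) auto
  with sub show ?thesis
    unfolding regular_perm_set_def by (intro exI[of _ ?m]) simp
qed

section \<open>A finite automaton for a closed set\<close>

text \<open>
  Subset construction over all choices \<open>bs\<close> of entries to delete. For each choice, two things are
  remembered: the marks of the \<open>k\<close> lowest entries, which suffice to process further letters as
  long as these are at most \<open>k\<close>, and the left quotient of \<open>L\<close> by the encoding of what is left.
\<close>

definition erase_states :: "nat \<Rightarrow> nat list set \<Rightarrow> nat list \<Rightarrow> (bool list \<times> nat list set) set" where
  "erase_states k L w =
     {(take k (marks bs w), left_quotient L (erase bs w)) | bs. length bs = length w}"

text \<open>
  The first pair arises when the new entry of rank \<open>p\<close> is kept, the second one when it is deleted.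
\<close>

definition erase_step ::
  "nat \<Rightarrow> nat \<Rightarrow> (bool list \<times> nat list set) set \<Rightarrow> (bool list \<times> nat list set) set" where
  "erase_step k p S =
     (\<Union>(l, K) \<in> S.
        {(take k (insert_at (p - 1) True l), {v. v @ [Suc (length (filter id (take (p - 1) l)))] \<in> K}),
         (take k (insert_at (p - 1) False l), K)})"

lemma take_insert_at_take:
  "i \<le> k \<Longrightarrow> take k (insert_at i x (take k l)) = take k (insert_at i x l)"
  by (simp add: insert_at_def min_def drop_take take_Cons')

lemma erase_states_Cons:
  assumes "p \<in> {1..k}"
  shows "erase_states k L (p # w) = erase_step k p (erase_states k L w)"
proof -
  let ?s = "\<lambda>bs w. (take k (marks bs w), left_quotient L (erase bs w))"
  let ?succ = "\<lambda>(l, K). {(take k (insert_at (p - 1) True l), {v. v @ [Suc (length (filter id (take (p - 1) l)))] \<in> K}),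
         (take k (insert_at (p - 1) False l), K)}"
  obtain i where p: "p = Suc i" and le: "i \<le> k" using assms by (cases p) auto
  have succ: "?succ (?s bs w) = {?s (True # bs) (p # w), ?s (False # bs) (p # w)}" for bs
    by (simp add: p take_insert_at_take[OF le] left_quotient_def min_absorb1[OF le])
  have "{bs. length bs = length (p # w)}
      = (\<Union>bs \<in> {bs. length bs = length w}. {True # bs, False # bs})"
    by (rule set_eqI, rename_tac bs, case_tac bs) auto
  then have "erase_states k L (p # w)
      = (\<lambda>bs. ?s bs (p # w)) ` (\<Union>bs \<in> {bs. length bs = length w}. {True # bs, False # bs})"
    unfolding erase_states_def by blast
  also have "\<dots> = (\<Union>bs \<in> {bs. length bs = length w}. {?s (True # bs) (p # w), ?s (False # bs) (p # w)})"
    by (simp only: image_UN image_insert image_empty)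
  also have "\<dots> = (\<Union>bs \<in> {bs. length bs = length w}. ?succ (?s bs w))"
    by (simp only: succ)
  also have "\<dots> = erase_step k p (erase_states k L w)"
    unfolding erase_step_def erase_states_def by blast
  finally show ?thesis .
qed

text \<open>
  The use of \<open>foldr\<close> means that the word is read from right to left.
\<close>

lemma deletion_automaton:
  assumes "finite (range (left_quotient L))"
  obtains \<Sigma> :: "(bool list \<times> nat list set) set set" and \<sigma>\<^sub>0 \<delta> F
  where "finite \<Sigma>" "\<sigma>\<^sub>0 \<in> \<Sigma>" "\<And>a s. s \<in> \<Sigma> \<Longrightarrow> \<delta> a s \<in> \<Sigma>"
    "\<And>w. w \<in> lists {1..k} \<Longrightarrow>
       foldr \<delta> w \<sigma>\<^sub>0 \<in> F \<longleftrightarrow> (\<exists>bs. length bs = length w \<and> erase bs w \<in> L)"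
proof
  let ?\<Sigma> = "Pow ({l :: bool list. length l \<le> k} \<times> range (left_quotient L))"
  have "finite {l :: bool list. length l \<le> k}"
    using finite_lists_length_le[of "UNIV :: bool set"] by simp
  then show "finite ?\<Sigma>" using assms by simp
  show "erase_states k L [] \<in> ?\<Sigma>"
    by (auto simp: erase_states_def)
  have "{v. v @ [a] \<in> left_quotient L u} = left_quotient L (a # u)" for a u
    by (simp add: left_quotient_def)
  then show "\<And>a s. s \<in> ?\<Sigma> \<Longrightarrow> erase_step k a s \<in> ?\<Sigma>"
    by (fastforce simp: erase_step_def)
  fix w assume "w \<in> lists {1..k}"
  then have "foldr (erase_step k) w (erase_states k L []) = erase_states k L w"
    by (induction w) (simp_all add: erase_states_Cons)
  moreover have "(\<exists>(l, K) \<in> erase_states k L w. [] \<in> K) \<longleftrightarrow>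
      (\<exists>bs. length bs = length w \<and> [] \<in> left_quotient L (erase bs w))"
    unfolding erase_states_def by blast
  ultimately show "foldr (erase_step k) w (erase_states k L []) \<in> {S. \<exists>(l, K) \<in> S. [] \<in> K} \<longleftrightarrow>
      (\<exists>bs. length bs = length w \<and> erase bs w \<in> L)"
    by (simp add: left_quotient_def)
qed

lemma closed_set_automaton:
  assumes "closed_perm_set X" "X \<subseteq> Omega k" "regular_perm_set (perm_basis X)"
  obtains \<Sigma> :: "(bool list \<times> nat list set) set set" and \<sigma>\<^sub>0 \<delta> F
  where "finite \<Sigma>" "\<sigma>\<^sub>0 \<in> \<Sigma>" "\<And>a s. s \<in> \<Sigma> \<Longrightarrow> \<delta> a s \<in> \<Sigma>"
    "\<And>\<pi>. is_perm \<pi> \<Longrightarrow> \<pi> \<in> X \<longleftrightarrow>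
       rank_encoding \<pi> \<in> lists {1..k} \<and> foldr \<delta> (rank_encoding \<pi>) \<sigma>\<^sub>0 \<in> F"
proof -
  let ?L = "rank_encoding ` perm_basis X"
  have "finite (range (left_quotient ?L))"
    using assms(3) finite_left_quotients by (auto simp: regular_perm_set_def)
  then obtain \<Sigma> :: "(bool list \<times> nat list set) set set" and \<sigma>0 \<delta> F
    where \<Sigma>: "finite \<Sigma>" "\<sigma>0 \<in> \<Sigma>" "\<And>a s. s \<in> \<Sigma> \<Longrightarrow> \<delta> a s \<in> \<Sigma>"
    and F: "\<And>w. w \<in> lists {1..k} \<Longrightarrow>
       foldr \<delta> w \<sigma>0 \<in> F \<longleftrightarrow> (\<exists>bs. length bs = length w \<and> erase bs w \<in> ?L)"
    using deletion_automaton[of ?L k] by metis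
  have "\<pi> \<in> X \<longleftrightarrow> rank_encoding \<pi> \<in> lists {1..k} \<and> foldr \<delta> (rank_encoding \<pi>) \<sigma>0 \<in> - F"
    if \<pi>: "is_perm \<pi>" for \<pi>
  proof -
    have "(\<exists>\<beta> \<in> perm_basis X. \<beta> \<preceq> \<pi>) \<longleftrightarrow> (\<exists>ys. subseq ys \<pi> \<and> rank_encoding ys \<in> ?L)"
      using \<pi> involved_iff_rank_encoding[of _ \<pi>] by (auto simp: perm_basis_def is_perm_def)
    also have "\<dots> \<longleftrightarrow> (\<exists>bs. length bs = length \<pi> \<and> erase bs (rank_encoding \<pi>) \<in> ?L)"
      by (metis subseq_iff_keep rank_encoding_keep)
    finally have "\<pi> \<in> X \<longleftrightarrow> \<not> (\<exists>bs. length bs = length \<pi> \<and> erase bs (rank_encoding \<pi>) \<in> ?L)"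
      using closed_iff_avoids_basis[OF assms(1) \<pi>] by simp
    moreover have "rank_encoding \<pi> \<in> lists {1..k} \<longleftrightarrow> \<pi> \<in> Omega k"
      by (simp add: Omega_iff_rank_encoding[OF \<pi>] lists_eq_set)
    ultimately show ?thesis
      using F[of "rank_encoding \<pi>", unfolded length_rank_encoding] assms(2) by blast
  qed
  with \<Sigma> show ?thesis by (rule that)
qed

section \<open>Linear recurrences from finite automata\<close>

interpretation fun_space: vector_space "\<lambda>(c :: 'a :: field) (f :: 's \<Rightarrow> 'a) s. c * f s"
  by unfold_locales (auto simp: fun_eq_iff algebra_simps)

lemma sum_apply: "(\<Sum>i\<in>I. f i) x = (\<Sum>i\<in>I. f i x)" for f :: "'i \<Rightarrow> 's \<Rightarrow> 'a :: comm_monoid_add"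
  by (induction I rule: infinite_finite_induct) (simp_all add: zero_fun_def)

text \<open>
  The vectors \<open>v n\<close> live in a space of dimension \<open>card S\<close>, so they cannot all be independent of
  their predecessors.
\<close>

lemma linear_dependence_in_sequence:
  fixes v :: "nat \<Rightarrow> 's \<Rightarrow> 'a :: field"
  assumes "finite S" "\<And>n s. s \<notin> S \<Longrightarrow> v n s = 0"
  obtains d c where "\<And>s. v d s = (\<Sum>i<d. c i * v i s)"
proof -
  let ?unit = "\<lambda>s t. if t = s then 1 else 0 :: 'a"
  have span: "v n \<in> fun_space.span (?unit ` S)" for n
  proof -
    have "v n = (\<Sum>s\<in>S. (\<lambda>t. v n s * ?unit s t))"
      using assms by (auto simp: fun_eq_iff sum_apply if_distrib cong: if_cong)
    also have "\<dots> \<in> fun_space.span (?unit ` S)"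
      by (intro fun_space.span_sum fun_space.span_scale fun_space.span_base) auto
    finally show ?thesis .
  qed
  have "\<exists>d. v d \<in> fun_space.span (v ` {..<d})"
  proof (rule ccontr)
    assume contr: "\<nexists>d. v d \<in> fun_space.span (v ` {..<d})"
    have indep: "fun_space.independent (v ` {..<n}) \<and> card (v ` {..<n}) = n" for n
    proof (induction n)
      case (Suc n)
      have "v n \<notin> v ` {..<n}" using contr fun_space.span_base by metis
      then show ?case
        using Suc contr by (simp add: lessThan_Suc fun_space.independent_insert)
    qed (simp add: fun_space.independent_empty)
    have "card (v ` {..<Suc (card S)}) \<le> card (?unit ` S)"
      using fun_space.independent_span_bound[of "?unit ` S"] indep span assms(1) by blast
    then show False
      using indep[of "Suc (card S)"] card_image_le[OF assms(1), of ?unit] by simp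
  qed
  then obtain d where d: "v d \<in> fun_space.span (v ` {..<d})" by blast
  have comb: "\<exists>c. \<forall>s. f s = (\<Sum>i<n. c i * v i s)" if "f \<in> fun_space.span (v ` {..<n})" for f n
    using that
  proof (induction n arbitrary: f)
    case (Suc n)
    then obtain b where "f - (\<lambda>s. b * v n s) \<in> fun_space.span (v ` {..<n})"
      unfolding lessThan_Suc image_insert fun_space.span_breakdown_eq by blast
    from Suc.IH[OF this] obtain c where c: "\<And>s. f s - b * v n s = (\<Sum>i<n. c i * v i s)" by auto
    have "f s = (\<Sum>i<Suc n. (c(n := b)) i * v i s)" for s
      using c[of s] by (simp add: algebra_simps)
    then show ?case by blast
  qed simp
  from comb[OF d] that show ?thesis by blast
qed

text \<open>
  If \<open>v (n + 1) = M v n\<close>, then a dependence of \<open>v d\<close> on the earlier vectors can be multiplied by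
  powers of \<open>M\<close>, which turns it into a recurrence for the whole sequence.
\<close>

lemma linear_system_recurrence:
  fixes v :: "nat \<Rightarrow> 's \<Rightarrow> 'a :: field"
  assumes "finite S"
    and "\<And>n t. t \<in> S \<Longrightarrow> v (Suc n) t = (\<Sum>s\<in>S. M t s * v n s)"
  obtains d c where "\<And>n s. s \<in> S \<Longrightarrow> v (n + d) s = (\<Sum>i<d. c i * v (n + i) s)"
proof -
  let ?v = "\<lambda>n s. if s \<in> S then v n s else 0"
  obtain d c where dc: "\<And>s. ?v d s = (\<Sum>i<d. c i * ?v i s)"
    by (rule linear_dependence_in_sequence[OF assms(1), of ?v]) auto
  then have base: "v d s = (\<Sum>i<d. c i * v i s)" if "s \<in> S" for s
    using that dc[of s] by simp
  have "v (n + d) s = (\<Sum>i<d. c i * v (n + i) s)" if "s \<in> S" for n s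
    using that
  proof (induction n arbitrary: s)
    case (Suc n)
    have "v (Suc n + d) s = (\<Sum>r\<in>S. M s r * (\<Sum>i<d. c i * v (n + i) r))"
      using assms(2)[OF Suc.prems] Suc.IH by simp
    also have "\<dots> = (\<Sum>i<d. c i * (\<Sum>r\<in>S. M s r * v (n + i) r))"
      unfolding sum_distrib_left by (subst sum.swap) (simp add: ac_simps)
    also have "\<dots> = (\<Sum>i<d. c i * v (Suc n + i) s)"
      using assms(2)[OF Suc.prems] by simp
    finally show ?case .
  qed (simp add: base)
  then show ?thesis by (rule that)
qed

lemma satisfies_linear_recurrence_if_shifted:
  fixes a :: "nat \<Rightarrow> 'a :: comm_ring_1"
  assumes "\<And>n. a (n + d + k) = (\<Sum>i<d. c i * a (n + i + k))"
  shows "satisfies_linear_recurrence a"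
  unfolding satisfies_linear_recurrence_def
proof (intro exI conjI allI impI)
  show "d \<le> d + k" by simp
  fix n assume n: "d + k \<le> n"
  let ?m = "n - (d + k)"
  have "a n = (\<Sum>i<d. c i * a (?m + i + k))"
    using assms[of ?m] n by (simp add: ac_simps)
  also have "\<dots> = (\<Sum>i=1..d. c (d - i) * a (n - i))"
    using n by (intro sum.reindex_bij_witness[of _ "\<lambda>i. d - i" "\<lambda>i. d - i"])
      (auto intro!: arg_cong[where f = a])
  finally show "a n = (\<Sum>i=1..d. c (d - i) * a (n - i))" .
qed

definition rank_words :: "nat \<Rightarrow> nat \<Rightarrow> nat list set" where
  "rank_words k n = {w \<in> lists {1..k}. length w = n \<and> rank_word w}"

lemma finite_rank_words: "finite (rank_words k n)"
  by (rule finite_subset[OF _ finite_lists_length_eq[of "{1..k}" n]])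
     (auto simp: rank_words_def)

text \<open>
  From length \<open>k\<close> on, every letter up to \<open>k\<close> is a possible rank. For shorter words this fails, and
  the recurrence starts only there.
\<close>

lemma rank_words_Suc:
  assumes "k \<le> Suc n"
  shows "rank_words k (Suc n) = (\<lambda>(p, w). p # w) ` ({1..k} \<times> rank_words k n)"
  using assms by (auto simp: rank_words_def length_Suc_conv image_iff)

text \<open>
  The transfer matrix method: counting the words of each length by the state that they lead to
  gives vectors, and passing to the next length multiplies them by the matrix that counts the
  letters leading from one state to another.
\<close>

lemma automaton_linear_recurrence:
  assumes "finite \<Sigma>" "\<sigma>\<^sub>0 \<in> \<Sigma>" "\<And>a s. s \<in> \<Sigma> \<Longrightarrow> \<delta> a s \<in> \<Sigma>"
  shows "satisfies_linear_recurrence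
    (\<lambda>n. of_nat (card {w \<in> rank_words k n. foldr \<delta> w \<sigma>\<^sub>0 \<in> F}) :: 'a :: field_char_0)"
proof -
  let ?W = "\<lambda>n s. {w \<in> rank_words k n. foldr \<delta> w \<sigma>\<^sub>0 = s}"
  let ?v = "\<lambda>n s. of_nat (card (?W (n + k) s)) :: 'a"
  let ?M = "\<lambda>t s. of_nat (card {p \<in> {1..k}. \<delta> p s = t}) :: 'a"
  have fin: "finite (?W n s)" for n s by (simp add: finite_rank_words)
  have run: "foldr \<delta> w \<sigma>\<^sub>0 \<in> \<Sigma>" for w
    by (induction w) (use assms in auto)
  have "?v (Suc n) t = (\<Sum>s\<in>\<Sigma>. ?M t s * ?v n s)" for n t
  proof -
    let ?pairs = "\<lambda>s. {p \<in> {1..k}. \<delta> p s = t} \<times> ?W (n + k) s"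
    have "?W (Suc n + k) t = (\<lambda>(p, w). p # w) ` (\<Union>s\<in>\<Sigma>. ?pairs s)"
      using run rank_words_Suc[of k "n + k"] by (auto simp: image_iff)
    moreover have "inj_on (\<lambda>(p, w). p # w) (\<Union>s\<in>\<Sigma>. ?pairs s)"
      by (auto simp: inj_on_def)
    ultimately have "card (?W (Suc n + k) t) = card (\<Union>s\<in>\<Sigma>. ?pairs s)"
      by (simp only: card_image)
    also have "\<dots> = (\<Sum>s\<in>\<Sigma>. card (?pairs s))"
      using assms(1) fin by (intro card_UN_disjoint) auto
    finally show ?thesis by (simp add: card_cartesian_product)
  qed
  then obtain d c where rec: "\<And>n s. s \<in> \<Sigma> \<Longrightarrow> ?v (n + d) s = (\<Sum>i<d. c i * ?v (n + i) s)"
    using linear_system_recurrence[OF assms(1), of ?v ?M] by blast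
  let ?a = "\<lambda>n. of_nat (card {w \<in> rank_words k n. foldr \<delta> w \<sigma>\<^sub>0 \<in> F}) :: 'a"
  have split: "?a (n + k) = (\<Sum>s\<in>\<Sigma> \<inter> F. ?v n s)" for n
  proof -
    have "{w \<in> rank_words k (n + k). foldr \<delta> w \<sigma>\<^sub>0 \<in> F} = (\<Union>s\<in>\<Sigma> \<inter> F. ?W (n + k) s)"
      using run by auto
    also have "card \<dots> = (\<Sum>s\<in>\<Sigma> \<inter> F. card (?W (n + k) s))"
      using assms(1) fin by (intro card_UN_disjoint) auto
    finally show ?thesis by simp
  qed
  show ?thesis
  proof (rule satisfies_linear_recurrence_if_shifted)
    fix n
    have "?a (n + d + k) = (\<Sum>s\<in>\<Sigma> \<inter> F. \<Sum>i<d. c i * ?v (n + i) s)"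
      unfolding split using rec by (intro sum.cong) auto
    also have "\<dots> = (\<Sum>i<d. c i * ?a (n + i + k))"
      unfolding split sum_distrib_left by (rule sum.swap)
    finally show "?a (n + d + k) = (\<Sum>i<d. c i * ?a (n + i + k))" .
  qed
qed

lemma enum_seq_eq_card_rank_words:
  assumes "\<And>\<pi>. \<pi> \<in> X \<Longrightarrow> is_perm \<pi>"
    and "\<And>\<pi>. is_perm \<pi> \<Longrightarrow>
      \<pi> \<in> X \<longleftrightarrow> rank_encoding \<pi> \<in> lists {1..k} \<and> P (rank_encoding \<pi>)"
  shows "enum_seq X n = card {w \<in> rank_words k n. P w}"
proof -
  have img: "rank_encoding ` {\<pi> \<in> X. length \<pi> = n} = {w \<in> rank_words k n. P w}"
  proof (intro equalityI subsetI)
    fix w assume "w \<in> rank_encoding ` {\<pi> \<in> X. length \<pi> = n}"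
    then obtain \<pi> where "\<pi> \<in> X" "length \<pi> = n" "w = rank_encoding \<pi>" by blast
    then show "w \<in> {w \<in> rank_words k n. P w}"
      using assms(1)[of \<pi>] assms(2)[of \<pi>] by (simp add: rank_words_def rank_word_rank_encoding)
  next
    fix w assume w: "w \<in> {w \<in> rank_words k n. P w}"
    then obtain \<pi> where \<pi>: "is_perm \<pi>" "w = rank_encoding \<pi>"
      using rank_word_imp_perm[of w] by (auto simp: rank_words_def)
    then have "\<pi> \<in> X" "length \<pi> = n"
      using w assms(2)[of \<pi>] by (auto simp: rank_words_def)
    with \<pi>(2) show "w \<in> rank_encoding ` {\<pi> \<in> X. length \<pi> = n}" by blast
  qed
  have inj: "inj_on rank_encoding {\<pi> \<in> X. length \<pi> = n}"
    using assms(1) by (intro inj_on_subset[OF inj_on_rank_encoding]) auto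
  show ?thesis
    unfolding enum_seq_def img[symmetric] by (rule card_image[OF inj, symmetric])
qed

section \<open>A linear-time machine\<close>

text \<open>
  The machine reads the permutation from right to left and runs an automaton with states \<open>\<Sigma>\<close> on
  its encoding. Register 0 holds the number of unread entries, register 1 the constant 1, register 2
  the entry just read, and the \<open>k\<close> registers from 3 on hold the \<open>k\<close> lowest values among the
  entries already processed. From these, the rank of a new entry is found by at most \<open>k\<close> comparisons.

  The program counter encodes the state \<open>s\<close> of the automaton together with a list \<open>rs\<close> of the \<open>k\<close>
  registers in increasing order of their contents. Hence inserting a new value means
  overwriting the register with the largest value and passing to another list, instead of moving
  the contents of the registers.
\<close>

datatype 's label =
    Start
  | Fill nat
  | Loop 's "nat list"
  | Scan 's "nat list" nat
  | Insert 's "nat list" nat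
  | Decide bool

locale rank_machine =
  fixes k :: nat and \<Sigma> :: "'s set" and \<sigma>\<^sub>0 :: 's and \<delta> :: "nat \<Rightarrow> 's \<Rightarrow> 's" and F :: "'s set"
  assumes k_pos: "1 \<le> k"
    and finite_states: "finite \<Sigma>"
    and initial_state: "\<sigma>\<^sub>0 \<in> \<Sigma>"
    and closed_states: "\<And>a s. s \<in> \<Sigma> \<Longrightarrow> \<delta> a s \<in> \<Sigma>"
begin

definition orders :: "nat list set" where
  "orders = {rs. set rs \<subseteq> {3..<k + 3} \<and> length rs = k}"

definition reorder :: "nat \<Rightarrow> nat list \<Rightarrow> nat list" where
  "reorder j rs = insert_at j (last rs) (butlast rs)"

fun valid_label :: "'s label \<Rightarrow> bool" where
  "valid_label (Fill j) \<longleftrightarrow> j \<le> k"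
| "valid_label (Loop s rs) \<longleftrightarrow> s \<in> \<Sigma> \<and> rs \<in> orders"
| "valid_label (Scan s rs j) \<longleftrightarrow> s \<in> \<Sigma> \<and> rs \<in> orders \<and> j \<le> k"
| "valid_label (Insert s rs j) \<longleftrightarrow> s \<in> \<Sigma> \<and> rs \<in> orders \<and> j \<le> k"
| "valid_label _ \<longleftrightarrow> True"

text \<open>
  Execution begins at address 0, so \<open>Start\<close> has to come first.
\<close>

definition label_list :: "'s label list" where
  "label_list = Start # (SOME ls. set ls = Collect valid_label)"

text \<open>
  Each label receives four consecutive cells of the program, enough for the longest block.
\<close>

definition address :: "'s label \<Rightarrow> nat" where
  "address l = 4 * (LEAST i. i < length label_list \<and> label_list ! i = l)"

text \<open>
  The value registers are initialised with \<open>n + 1\<close>, where \<open>n\<close> is the length of the input. This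
  exceeds all entries and so stands for a missing value. In \<open>Scan s rs j\<close>, the entry just read
  is not below any of the values of the first \<open>j\<close> registers in \<open>rs\<close>. If it is below the next one, then its rank is
  \<open>j + 1\<close>; if there is no next one, then its rank exceeds \<open>k\<close>.
\<close>

fun block :: "'s label \<Rightarrow> instr list" where
  "block Start = [Const 1 1, Jump (address (Fill 0))]"
| "block (Fill j) =
     (if j < k then [Add (j + 3) 0 1, Jump (address (Fill (Suc j)))]
      else [Jump (address (Loop \<sigma>\<^sub>0 [3..<k + 3]))])"
| "block (Loop s rs) =
     [JumpLess 0 1 (address (Decide (s \<in> F))), Load 2 0, Sub 0 0 1, Jump (address (Scan s rs 0))]"
| "block (Scan s rs j) =
     (if j < k
      then [JumpLess 2 (rs ! j) (address (Insert s rs j)), Jump (address (Scan s rs (Suc j)))]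
      else [Halt False])"
| "block (Insert s rs j) =
     [Copy (last rs) 2, Jump (address (Loop (\<delta> (Suc j) s) (reorder j rs)))]"
| "block (Decide b) = [Halt b]"

definition program :: "instr list" where
  "program = map (\<lambda>i. block (label_list ! (i div 4)) ! (i mod 4)) [0..<4 * length label_list]"

definition accepts :: "nat list \<Rightarrow> bool" where
  "accepts xs \<longleftrightarrow>
     set (rank_encoding xs) \<subseteq> {1..k} \<and> foldr \<delta> (rank_encoding xs) \<sigma>\<^sub>0 \<in> F"

lemma finite_valid_labels: "finite (Collect valid_label)"
proof -
  let ?C = "\<Sigma> \<times> orders \<times> {..k}"
  have "finite orders" unfolding orders_def by (rule finite_lists_length_eq) simp
  then have fin: "finite ?C" using finite_states by simp
  have "Collect valid_label \<subseteq> {Start, Decide True, Decide False} \<union> Fill ` {..k} \<union>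
     (\<lambda>(s, rs, j). Loop s rs) ` ?C \<union> (\<lambda>(s, rs, j). Scan s rs j) ` ?C \<union>
     (\<lambda>(s, rs, j). Insert s rs j) ` ?C"
  proof
    fix l assume "l \<in> Collect valid_label"
    then show "l \<in> {Start, Decide True, Decide False} \<union> Fill ` {..k} \<union>
     (\<lambda>(s, rs, j). Loop s rs) ` ?C \<union> (\<lambda>(s, rs, j). Scan s rs j) ` ?C \<union>
     (\<lambda>(s, rs, j). Insert s rs j) ` ?C"
      by (cases l) (auto simp: image_iff)
  qed
  then show ?thesis by (rule finite_subset) (use fin in simp)
qed

lemma set_label_list: "set label_list = Collect valid_label"
proof -
  have "set (SOME ls. set ls = Collect valid_label) = Collect valid_label"
    by (rule someI_ex[OF finite_list[OF finite_valid_labels]])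
  then show ?thesis by (auto simp: label_list_def)
qed

lemma address_Start: "address Start = 0"
  by (simp add: address_def label_list_def Least_eq_0)

lemma program_at_address:
  assumes "valid_label l" "r < 4"
  shows "address l + r < length program" "program ! (address l + r) = block l ! r"
proof -
  define i where "i = (LEAST i. i < length label_list \<and> label_list ! i = l)"
  have "\<exists>i. i < length label_list \<and> label_list ! i = l"
    using assms(1) set_label_list by (metis in_set_conv_nth mem_Collect_eq)
  then have i: "i < length label_list" "label_list ! i = l"
    unfolding i_def by (metis (mono_tags, lifting) LeastI_ex)+
  have addr: "address l = 4 * i" by (simp add: address_def i_def)
  show "address l + r < length program"
    using i(1) assms(2) by (simp add: addr program_def)
  then show "program ! (address l + r) = block l ! r"
    using assms(2) i(2) by (simp add: addr program_def)
qed

lemma step_block: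
  assumes "valid_label l" "r < 4"
  shows "step program \<lparr>pc = address l + r, reg = R, mem = M\<rparr>
       = exec (block l ! r) \<lparr>pc = address l + r, reg = R, mem = M\<rparr>"
  using program_at_address[OF assms] by (simp add: step_def)

lemmas step_blocks =
  step_block[where r = 0, simplified] step_block[where r = 1, simplified]
  step_block[where r = 2, simplified] step_block[where r = "Suc (Suc (Suc 0))", simplified]

abbreviation at_label :: "'s label \<Rightarrow> (nat \<Rightarrow> nat) \<Rightarrow> (nat \<Rightarrow> nat) \<Rightarrow> config" where
  "at_label l R M \<equiv> \<lparr>pc = address l, reg = R, mem = M\<rparr>"

lemma start_steps:
  "(step program ^^ 2) (at_label Start R M) = at_label (Fill 0) (R(1 := 1)) M"
  by (simp add: numeral_2_eq_2 step_blocks)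

lemma fill_steps:
  assumes "R 1 = 1" "j \<le> k"
  shows "(step program ^^ (2 * j)) (at_label (Fill 0) R M)
       = at_label (Fill j) (\<lambda>r. if 3 \<le> r \<and> r < j + 3 then Suc (R 0) else R r) M"
  using assms(2)
proof (induction j)
  case (Suc j)
  have "valid_label (Fill j)" using Suc.prems by simp
  then show ?case
    using Suc assms(1) by (simp add: step_blocks fun_eq_iff less_Suc_eq)
qed (simp add: fun_eq_iff)

lemma enter_loop:
  "(step program ^^ 1) (at_label (Fill k) R M) = at_label (Loop \<sigma>\<^sub>0 [3..<k + 3]) R M"
  by (simp add: step_blocks)

lemma read_steps:
  assumes "s \<in> \<Sigma>" "rs \<in> orders" "R 1 = 1" "R 0 = Suc i"
  shows "(step program ^^ 4) (at_label (Loop s rs) R M)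
       = at_label (Scan s rs 0) (R(2 := M (Suc i), 0 := i)) M"
proof -
  have "valid_label (Loop s rs)" using assms(1,2) by simp
  then show ?thesis
    using assms(3,4) by (simp add: eval_nat_numeral step_blocks fun_upd_twist)
qed

lemma scan_steps:
  assumes "s \<in> \<Sigma>" "rs \<in> orders" "j \<le> k" "\<And>i. i < j \<Longrightarrow> R (rs ! i) \<le> R 2"
  shows "(step program ^^ (2 * j)) (at_label (Scan s rs 0) R M) = at_label (Scan s rs j) R M"
  using assms(3,4)
proof (induction j)
  case (Suc j)
  have "valid_label (Scan s rs j)" using Suc.prems assms(1,2) by simp
  moreover have "\<not> R 2 < R (rs ! j)" using Suc.prems(2)[of j] by simp
  ultimately show ?case
    using Suc by (simp add: step_blocks)
qed simp

lemma insert_steps: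
  assumes "s \<in> \<Sigma>" "rs \<in> orders" "j < k" "R 2 < R (rs ! j)"
  shows "(step program ^^ 3) (at_label (Scan s rs j) R M)
       = at_label (Loop (\<delta> (Suc j) s) (reorder j rs)) (R(last rs := R 2)) M"
proof -
  have "valid_label (Scan s rs j)" "valid_label (Insert s rs j)"
    using assms by simp_all
  then show ?thesis
    using assms(3,4) by (simp add: eval_nat_numeral step_blocks)
qed

text \<open>
  The contents of the registers \<open>rs\<close> are the \<open>k\<close> lowest members of \<open>xs\<close> in increasing order, filled
  up with values above \<open>n\<close>. Expressing this by thresholds \<open>t\<close> avoids sorting and fits the counts that
  the encoding is made of.
\<close>

definition holds_lowest :: "nat \<Rightarrow> nat list \<Rightarrow> (nat \<Rightarrow> nat) \<Rightarrow> nat list \<Rightarrow> bool" where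
  "holds_lowest n xs R rs \<longleftrightarrow>
     rs \<in> orders \<and> distinct rs \<and> R 1 = 1 \<and>
     (\<forall>j < k. \<forall>t \<le> n. R (rs ! j) \<le> t \<longleftrightarrow> j < count_le t xs)"

text \<open>
  Inserting \<open>x\<close> behind the values that do not exceed it keeps the counts right: for a threshold
  \<open>t \<ge> x\<close>, all values before the new one are counted already, and for \<open>t < x\<close>, none of the values
  after it is counted.
\<close>

lemma holds_lowest_Cons:
  assumes "holds_lowest n xs R rs" "count_le x xs < k"
  shows "holds_lowest n (x # xs) (R(2 := x, 0 := i, last rs := x)) (reorder (count_le x xs) rs)"
proof -
  let ?p = "count_le x xs" and ?R = "R(2 := x, 0 := i, last rs := x)"
  have rs: "set rs \<subseteq> {3..<k + 3}" "length rs = k" "distinct rs"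
    and R1: "R 1 = 1"
    and low: "\<And>j t. j < k \<Longrightarrow> t \<le> n \<Longrightarrow> R (rs ! j) \<le> t \<longleftrightarrow> j < count_le t xs"
    using assms(1) by (auto simp: holds_lowest_def orders_def)
  have ne: "rs \<noteq> []" using rs(2) k_pos by auto
  then have split: "rs = butlast rs @ [last rs]" by simp
  have dist: "last rs \<notin> set (butlast rs)" "distinct (butlast rs)"
    using rs(3) by (subst (asm) split, simp)+
  have mem: "insert (last rs) (set (butlast rs)) = set rs"
    by (subst (3) split) simp
  have old: "?R (rs ! j) = R (rs ! j)" if "j < k - 1" for j
  proof -
    have "rs ! j = butlast rs ! j" using that rs(2) by (simp add: nth_butlast)
    then have "rs ! j \<in> set (butlast rs)" using that rs(2) by simp
    then have "rs ! j \<noteq> last rs" "3 \<le> rs ! j" using dist(1) mem rs(1) by auto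
    then show ?thesis by simp
  qed
  have "?R (reorder ?p rs ! j) \<le> t \<longleftrightarrow> j < count_le t (x # xs)" if j: "j < k" and t: "t \<le> n" for j t
  proof -
    have nth: "reorder ?p rs ! j = (if j < ?p then rs ! j else if j = ?p then last rs else rs ! (j - 1))"
      using j assms(2) rs(2) by (auto simp: reorder_def nth_insert_at nth_butlast)
    consider "j < ?p" | "j = ?p" | "?p < j" by linarith
    then show ?thesis
    proof cases
      case 1
      then show ?thesis
        using nth old[of j] low[OF j t] assms(2) count_le_mono[of x t xs] by auto
    next
      case 2
      then show ?thesis
        using nth count_le_mono[of x t xs] count_le_mono[of t x xs] by auto
    next
      case 3
      then show ?thesis
        using nth old[of "j - 1"] low[of "j - 1" t] j t count_le_mono[of t x xs] by auto
    qed
  qed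
  moreover have "reorder ?p rs \<in> orders" "distinct (reorder ?p rs)"
    using rs k_pos dist mem by (auto simp: orders_def reorder_def)
  moreover have "3 \<le> last rs" using rs(1) last_in_set[OF ne] by auto
  then have "?R 1 = 1" using R1 by simp
  ultimately show ?thesis by (simp add: holds_lowest_def)
qed

definition halts_within :: "nat \<Rightarrow> config \<Rightarrow> bool \<Rightarrow> bool" where
  "halts_within t c b \<longleftrightarrow> (\<exists>s \<le> t. answers program ((step program ^^ s) c) b)"

lemma halts_within_steps:
  assumes "(step program ^^ u) c = c'" "halts_within t c' b" "u + t \<le> t'"
  shows "halts_within t' c b"
proof -
  from assms(2) obtain s where s: "s \<le> t" "answers program ((step program ^^ s) c') b"
    by (auto simp: halts_within_def)
  have "(step program ^^ (s + u)) c = (step program ^^ s) c'"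
    using assms(1) by (simp add: funpow_add)
  with s assms(3) show ?thesis
    unfolding halts_within_def by (intro exI[of _ "s + u"]) simp
qed

lemma halts_at:
  assumes "valid_label l" "block l ! 0 = Halt b"
  shows "halts_within t (at_label l R M) b"
  using program_at_address[OF assms(1), of 0] assms(2)
  by (auto simp: halts_within_def answers_def intro!: exI[of _ 0])

lemma run_in_states: "foldr \<delta> w \<sigma>\<^sub>0 \<in> \<Sigma>"
  by (induction w) (simp_all add: initial_state closed_states)

text \<open>
  One entry costs 4 steps for reading it, at most \<open>2 * k\<close> for scanning the registers and 3 for the
  insertion. A rank above \<open>k\<close> ends the computation early.
\<close>

lemma loop_halts:
  assumes "set xs \<subseteq> {..n}" "\<And>i. i < length xs \<Longrightarrow> M (Suc i) = xs ! i"
    and "i \<le> length xs" "R 0 = i" "holds_lowest n (drop i xs) R rs"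
    and "set (rank_encoding (drop i xs)) \<subseteq> {1..k}"
  shows "halts_within ((2 * k + 7) * i + 1)
    (at_label (Loop (foldr \<delta> (rank_encoding (drop i xs)) \<sigma>\<^sub>0) rs) R M) (accepts xs)"
  using assms(3-)
proof (induction i arbitrary: R rs)
  case 0
  let ?s = "foldr \<delta> (rank_encoding xs) \<sigma>\<^sub>0"
  have "rs \<in> orders" "R 1 = 1" using "0.prems"(3) by (auto simp: holds_lowest_def)
  then have "valid_label (Loop ?s rs)" using run_in_states by simp
  then have "(step program ^^ 1) (at_label (Loop ?s rs) R M) = at_label (Decide (?s \<in> F)) R M"
    using "0.prems"(2) \<open>R 1 = 1\<close> by (simp add: step_blocks)
  moreover have "halts_within 0 (at_label (Decide (?s \<in> F)) R M) (?s \<in> F)"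
    by (rule halts_at) (simp_all)
  moreover have "accepts xs \<longleftrightarrow> ?s \<in> F" using "0.prems"(4) by (simp add: accepts_def)
  ultimately show ?case
    using halts_within_steps[of 1 _ _ 0] by simp
next
  case (Suc i)
  define x where "x = xs ! i"
  define ys where "ys = drop (Suc i) xs"
  define s where "s = foldr \<delta> (rank_encoding ys) \<sigma>\<^sub>0"
  define R' where "R' = R(2 := x, 0 := i)"
  let ?p = "count_le x ys"
  have i: "i < length xs" using Suc.prems(1) by simp
  have drop: "drop i xs = x # ys" using i by (simp add: x_def ys_def Cons_nth_drop_Suc)
  have low: "holds_lowest n ys R rs" using Suc.prems(3) by (simp add: ys_def)
  have "x \<le> n" using assms(1) nth_mem[OF i] by (auto simp: x_def)
  with low have rs: "rs \<in> orders" "R 1 = 1"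
    and cmp: "\<And>j. j < k \<Longrightarrow> R (rs ! j) \<le> x \<longleftrightarrow> j < ?p"
    by (simp_all add: holds_lowest_def)
  have s: "s \<in> \<Sigma>" unfolding s_def by (rule run_in_states)
  have read: "(step program ^^ 4) (at_label (Loop s rs) R M) = at_label (Scan s rs 0) R' M"
    using read_steps[OF s rs Suc.prems(2)] assms(2)[OF i] by (simp add: x_def R'_def)
  have reg: "R' (rs ! j) = R (rs ! j)" if "j < k" for j
  proof -
    have "rs ! j \<in> set rs" using rs(1) that by (simp add: orders_def)
    then have "rs ! j \<in> {3..<k + 3}" using rs(1) unfolding orders_def by blast
    then show ?thesis by (simp add: R'_def)
  qed
  have R'2: "R' 2 = x" by (simp add: R'_def)
  \<comment> \<open>The scan stops at a position below \<open>k\<close> if and only if the rank of \<open>x\<close> is at most \<open>k\<close>.\<close>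
  have "halts_within ((2 * k + 7) * Suc i + 1) (at_label (Loop s rs) R M) (accepts xs)"
  proof (cases "?p < k")
    case True
    have scan: "(step program ^^ (2 * ?p)) (at_label (Scan s rs 0) R' M) = at_label (Scan s rs ?p) R' M"
      using True cmp reg R'2 by (intro scan_steps[OF s rs(1)]) auto
    have insert: "(step program ^^ 3) (at_label (Scan s rs ?p) R' M)
        = at_label (Loop (\<delta> (Suc ?p) s) (reorder ?p rs)) (R'(last rs := x)) M"
      using True cmp[OF True] reg[OF True] R'2 by (subst insert_steps[OF s rs(1)]) auto
    have "holds_lowest n (drop i xs) (R'(last rs := x)) (reorder ?p rs)"
      unfolding drop R'_def by (rule holds_lowest_Cons[OF low True])
    moreover have "(R'(last rs := x)) 0 = i"
    proof -
      have "last rs \<in> set rs" using rs(1) k_pos by (intro last_in_set) (auto simp: orders_def)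
      then have "last rs \<in> {3..<k + 3}" using rs(1) unfolding orders_def by blast
      then show ?thesis by (auto simp: R'_def)
    qed
    moreover have "set (rank_encoding (drop i xs)) \<subseteq> {1..k}"
      using Suc.prems(4) True by (simp add: drop ys_def)
    ultimately have "halts_within ((2 * k + 7) * i + 1)
        (at_label (Loop (foldr \<delta> (rank_encoding (drop i xs)) \<sigma>\<^sub>0) (reorder ?p rs)) (R'(last rs := x)) M) (accepts xs)"
      using Suc.IH i by simp
    then have rest: "halts_within ((2 * k + 7) * i + 1)
        (at_label (Loop (\<delta> (Suc ?p) s) (reorder ?p rs)) (R'(last rs := x)) M) (accepts xs)"
      by (simp add: drop s_def)
    have "halts_within ((2 * k + 7) * i + 4) (at_label (Scan s rs ?p) R' M) (accepts xs)"
      by (rule halts_within_steps[OF insert rest]) simp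
    then have "halts_within ((2 * k + 7) * i + 4 + 2 * k) (at_label (Scan s rs 0) R' M) (accepts xs)"
      by (rule halts_within_steps[OF scan]) (use True in simp)
    then show ?thesis
      by (rule halts_within_steps[OF read]) simp
  next
    case False
    have "\<not> accepts xs"
    proof
      assume "accepts xs"
      then have "set (rank_encoding (drop i xs)) \<subseteq> {1..k}"
        using set_drop_subset[of i "rank_encoding xs"] by (auto simp: accepts_def rank_encoding_drop)
      with False show False by (simp add: drop)
    qed
    moreover have scan: "(step program ^^ (2 * k)) (at_label (Scan s rs 0) R' M) = at_label (Scan s rs k) R' M"
      using False cmp reg R'2 by (intro scan_steps[OF s rs(1)]) auto
    moreover have "halts_within 0 (at_label (Scan s rs k) R' M) False"
      by (rule halts_at) (use s rs(1) in \<open>auto\<close>)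
    ultimately have "halts_within (2 * k) (at_label (Scan s rs 0) R' M) (accepts xs)"
      using halts_within_steps[of "2 * k" _ _ 0] by simp
    then show ?thesis
      by (rule halts_within_steps[OF read]) simp
  qed
  then show ?case by (simp only: s_def ys_def)
qed

lemma program_halts:
  assumes "set xs \<subseteq> {..length xs}"
  shows "answers_within program xs ((2 * k + 7) * length xs + 2 * k + 4) (accepts xs)"
proof -
  let ?n = "length xs" and ?c = "initial_config xs"
  let ?R = "(reg ?c)(1 := 1)" and ?M = "mem ?c"
  let ?R' = "\<lambda>r. if 3 \<le> r \<and> r < k + 3 then Suc (?R 0) else ?R r"
  have "holds_lowest ?n [] ?R' [3..<k + 3]"
    by (auto simp: holds_lowest_def orders_def initial_config_def)
  then have loop: "halts_within ((2 * k + 7) * ?n + 1) (at_label (Loop \<sigma>\<^sub>0 [3..<k + 3]) ?R' ?M) (accepts xs)"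
    using loop_halts[OF assms, of ?M ?n ?R' "[3..<k + 3]"] by (simp add: initial_config_def)
  have start: "(step program ^^ 2) ?c = at_label (Fill 0) ?R ?M"
    using start_steps[of "reg ?c" ?M] by (simp add: initial_config_def address_Start)
  have fill: "(step program ^^ (2 * k)) (at_label (Fill 0) ?R ?M) = at_label (Fill k) ?R' ?M"
    by (rule fill_steps) simp_all
  have "halts_within ((2 * k + 7) * ?n + 2) (at_label (Fill k) ?R' ?M) (accepts xs)"
    by (rule halts_within_steps[OF enter_loop loop]) simp
  then have "halts_within ((2 * k + 7) * ?n + 2 * k + 2) (at_label (Fill 0) ?R ?M) (accepts xs)"
    by (rule halts_within_steps[OF fill]) simp
  then have "halts_within ((2 * k + 7) * ?n + 2 * k + 4) ?c (accepts xs)"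
    by (rule halts_within_steps[OF start]) simp
  then show ?thesis by (simp add: halts_within_def answers_within_def)
qed

lemma linear_time:
  assumes "\<And>\<pi>. is_perm \<pi> \<Longrightarrow> \<pi> \<in> X \<longleftrightarrow> accepts \<pi>"
  shows "linear_time_membership X"
  unfolding linear_time_membership_def
proof (intro exI conjI allI impI)
  let ?T = "\<lambda>n. (2 * k + 7) * n + 2 * k + 4"
  have "real (?T n) \<le> (4 * real k + 11) * real n" if "1 \<le> n" for n
  proof -
    have "?T n \<le> (2 * k + 7) * n + (2 * k + 4) * n" using that by (simp add: mult_le_mono)
    also have "\<dots> = (4 * k + 11) * n" by (simp add: algebra_simps)
    finally show ?thesis by (simp flip: of_nat_le_iff[where 'a = real])
  qed
  then show "(\<lambda>n. real (?T n)) \<in> O(\<lambda>n. real n)"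
    by (intro bigoI[of _ "4 * real k + 11"] eventually_sequentiallyI[of 1]) simp
  fix \<pi> assume \<pi>: "is_perm \<pi>"
  then have "set \<pi> \<subseteq> {..length \<pi>}" by (auto simp: is_perm_def)
  then show "answers_within program \<pi> (?T (length \<pi>)) (\<pi> \<in> X)"
    using program_halts assms[OF \<pi>] by simp
qed

end

section \<open>Closed sets with a regular basis\<close>

theorem corollary3:
  fixes k :: nat and X :: "nat list set"
  assumes "k \<ge> 1"
    and "closed_perm_set X"
    and "X \<subseteq> Omega k"
  shows "(finite (perm_basis X) \<longrightarrow> regular_perm_set (perm_basis X)) \<and>
         (regular_perm_set (perm_basis X) \<longrightarrow>
            satisfies_linear_recurrence (\<lambda>n. rat_of_nat (enum_seq X n)) \<and>
            linear_time_membership X)"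
proof (intro conjI impI)
  assume "finite (perm_basis X)"
  then show "regular_perm_set (perm_basis X)"
    by (rule finite_imp_regular_perm_set) (simp add: perm_basis_def)
next
  assume "regular_perm_set (perm_basis X)"
  then obtain \<Sigma> :: "(bool list \<times> nat list set) set set" and \<sigma>\<^sub>0 \<delta> F
    where \<Sigma>: "finite \<Sigma>" "\<sigma>\<^sub>0 \<in> \<Sigma>" "\<And>a s. s \<in> \<Sigma> \<Longrightarrow> \<delta> a s \<in> \<Sigma>"
    and X: "\<And>\<pi>. is_perm \<pi> \<Longrightarrow> \<pi> \<in> X \<longleftrightarrow>
       rank_encoding \<pi> \<in> lists {1..k} \<and> foldr \<delta> (rank_encoding \<pi>) \<sigma>\<^sub>0 \<in> F"
    using closed_set_automaton[OF assms(2,3)] by metis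
  have "enum_seq X n = card {w \<in> rank_words k n. foldr \<delta> w \<sigma>\<^sub>0 \<in> F}" for n
    using assms(2) X by (intro enum_seq_eq_card_rank_words) (auto simp: closed_perm_set_def)
  then show "satisfies_linear_recurrence (\<lambda>n. rat_of_nat (enum_seq X n))"
    using automaton_linear_recurrence[OF \<Sigma>] by simp
  interpret rank_machine k \<Sigma> \<sigma>\<^sub>0 \<delta> F
    by unfold_locales (use assms(1) \<Sigma> in auto)
  show "linear_time_membership X"
    by (rule linear_time) (simp add: X accepts_def lists_eq_set)
qed

end
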